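(* For every $d\in\mathbb{N}$, let $T_d$ be a compact linear operator of norm one between Hilbert spaces and let $T_d^d$ be its $d$th tensor power. Assume that for every $n\in\mathbb{N}$ the approximation number $a_n(T_d)$ is nonincreasing in $d$, and that $a_n(T_1)$ decays polynomially in $n$. Then the following are equivalent: the problem $\{T_d^d\}$ is strongly polynomially tractable; the problem $\{T_d^d\}$ is polynomially tractable; $a_2(T_d)$ decays polynomially in $d$.
   Context: $\mathbb{N}=\{1,2,\dots\}$. For a compact linear operator $T:X\to Y$ between Hilbert spaces, the $n$th approximation number is $a_n(T)=\inf\{\|T-A\| : A:X\to Y \text{ bounded linear},\ \operatorname{rank}(A)<n\}$. The $d$th tensor power $T^d:X^d\to Y^d$ is the bounded linear operator between the $d$-fold Hilbert space tensor powers $X^d=X\otimes\dots\otimes X$ and $Y^d=Y\otimes\dots\otimes Y$ determined by $T^d(f_1\otimes\dots\otimes f_d)=Tf_1\otimes\dots\otimes Tf_d$. A nonnegative sequence $(x_m)$ decays polynomially in $m$ if there are $C,p>0$ with $x_m\le C m^{-p}$ for all $m\in\mathbb{N}$. The problem $\{T_d^d\}$ is that of approximating $T_d^d$ on the unit ball of its domain, in the worst case, by algorithms using at most $n$ continuous linear functionals; its $n$th minimal worst case error is $e(n,d)=a_{n+1}(T_d^d)$ and its information complexity is $n(\varepsilon,d)=\min\{n\in\mathbb{N}\cup\{0\} : e(n,d)<\varepsilon\}=\#\{n\in\mathbb{N} : a_n(T_d^d)\ge\varepsilon\}$. The problem is polynomially tractable if there are nonnegative numbers $C,p,q$ with $n(\varepsilon,d)\le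 C\,\varepsilon^{-q}d^{p}$ for all $d\in\mathbb{N}$ and $\varepsilon>0$; it is strongly polynomially tractable if this holds with $p=0$. *)

theory Defs
  imports "HOL-Analysis.Analysis"
begin

text \<open>
  The library has no Hilbert spaces over the complex numbers, and a family of Hilbert spaces
  indexed by \<open>d\<close> cannot be a family of types.  A Hilbert space is therefore a record consisting of
  a carrier, a scalar multiplication and an inner product; only the addition is taken from the
  ambient type.  This is no restriction: the members of any family of Hilbert spaces
  are, as additive groups, subgroups of the direct product of the family.  The scalar field \<open>K\<close> is
  \<open>\<real>\<close> (as a subset of the complex numbers) or \<open>UNIV :: complex set\<close>, so that
  real and complex Hilbert spaces are treated uniformly.
\<close>

record 'a hilbert =
  space\<^sub>H :: "'a set"
  scale\<^sub>H :: "complex \<Rightarrow> 'a \<Rightarrow> 'a"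
  inner\<^sub>H :: "'a \<Rightarrow> 'a \<Rightarrow> complex"

definition norm\<^sub>H :: "'a::ab_group_add hilbert \<Rightarrow> 'a \<Rightarrow> real" where
  "norm\<^sub>H X x = sqrt (Re (inner\<^sub>H X x x))"

(* The value 0 off the carrier is needed because the library's Metric_space demands that the
   distance function be nonnegative and symmetric on the whole type. *)
definition dist\<^sub>H :: "'a::ab_group_add hilbert \<Rightarrow> 'a \<Rightarrow> 'a \<Rightarrow> real" where
  "dist\<^sub>H X x y = (if x \<in> space\<^sub>H X \<and> y \<in> space\<^sub>H X then norm\<^sub>H X (x - y) else 0)"

abbreviation topology\<^sub>H :: "'a::ab_group_add hilbert \<Rightarrow> 'a topology" where
  "topology\<^sub>H X \<equiv> Metric_space.mtopology (space\<^sub>H X) (dist\<^sub>H X)"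

locale hilbert_space =
  fixes K :: "complex set" and X :: "'a::ab_group_add hilbert"
  assumes field: "K = \<real> \<or> K = UNIV"
    and zero_closed: "0 \<in> space\<^sub>H X"
    and add_closed: "\<lbrakk>x \<in> space\<^sub>H X; y \<in> space\<^sub>H X\<rbrakk> \<Longrightarrow> x + y \<in> space\<^sub>H X"
    and scale_closed: "\<lbrakk>a \<in> K; x \<in> space\<^sub>H X\<rbrakk> \<Longrightarrow> scale\<^sub>H X a x \<in> space\<^sub>H X"
    and scale_add_right: "\<lbrakk>a \<in> K; x \<in> space\<^sub>H X; y \<in> space\<^sub>H X\<rbrakk> \<Longrightarrow>
          scale\<^sub>H X a (x + y) = scale\<^sub>H X a x + scale\<^sub>H X a y"
    and scale_add_left: "\<lbrakk>a \<in> K; b \<in> K; x \<in> space\<^sub>H X\<rbrakk> \<Longrightarrow>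
          scale\<^sub>H X (a + b) x = scale\<^sub>H X a x + scale\<^sub>H X b x"
    and scale_scale: "\<lbrakk>a \<in> K; b \<in> K; x \<in> space\<^sub>H X\<rbrakk> \<Longrightarrow>
          scale\<^sub>H X a (scale\<^sub>H X b x) = scale\<^sub>H X (a * b) x"
    and scale_one: "x \<in> space\<^sub>H X \<Longrightarrow> scale\<^sub>H X 1 x = x"
    and inner_scalar: "\<lbrakk>x \<in> space\<^sub>H X; y \<in> space\<^sub>H X\<rbrakk> \<Longrightarrow> inner\<^sub>H X x y \<in> K"
    and inner_commute: "\<lbrakk>x \<in> space\<^sub>H X; y \<in> space\<^sub>H X\<rbrakk> \<Longrightarrow> inner\<^sub>H X x y = cnj (inner\<^sub>H X y x)"
    and inner_add_left: "\<lbrakk>x \<in> space\<^sub>H X; y \<in> space\<^sub>H X; z \<in> space\<^sub>H X\<rbrakk> \<Longrightarrow>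
          inner\<^sub>H X (x + y) z = inner\<^sub>H X x z + inner\<^sub>H X y z"
    and inner_scale_left: "\<lbrakk>a \<in> K; x \<in> space\<^sub>H X; y \<in> space\<^sub>H X\<rbrakk> \<Longrightarrow>
          inner\<^sub>H X (scale\<^sub>H X a x) y = a * inner\<^sub>H X x y"
    and inner_pos: "\<lbrakk>x \<in> space\<^sub>H X; x \<noteq> 0\<rbrakk> \<Longrightarrow> 0 < Re (inner\<^sub>H X x x)"
    and complete: "Metric_space.mcomplete (space\<^sub>H X) (dist\<^sub>H X)"

text \<open>
  The constants of the library's locale of metric spaces used here are meaningful: the distance
  of a Hilbert space is a metric.
\<close>

context hilbert_space
begin

lemma Reals_scalar: "complex_of_real r \<in> K"
  using field by auto

lemma minus_closed: assumes "x \<in> space\<^sub>H X" shows "- x \<in> space\<^sub>H X"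
  and scale_minus_one: "scale\<^sub>H X (-1) x = - x"
proof -
  have m: "-1 \<in> K" and z: "0 \<in> K" and o: "1 \<in> K"
    using Reals_scalar[of "-1"] Reals_scalar[of 0] Reals_scalar[of 1] by auto
  have "scale\<^sub>H X (0 + 0) x = scale\<^sub>H X 0 x + scale\<^sub>H X 0 x"
    using scale_add_left[OF z z assms] .
  then have "scale\<^sub>H X 0 x = 0" by simp
  moreover have "scale\<^sub>H X (-1 + 1) x = scale\<^sub>H X (-1) x + x"
    using scale_add_left[OF m o assms] scale_one[OF assms] by simp
  ultimately show "scale\<^sub>H X (-1) x = - x" by (simp add: eq_neg_iff_add_eq_0)
  then show "- x \<in> space\<^sub>H X" using scale_closed[OF m assms] by simp
qed

lemma diff_closed: "\<lbrakk>x \<in> space\<^sub>H X; y \<in> space\<^sub>H X\<rbrakk> \<Longrightarrow> x - y \<in> space\<^sub>H X"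
  using add_closed[of x "- y"] minus_closed[of y] by simp

lemma inner_zero: "x \<in> space\<^sub>H X \<Longrightarrow> inner\<^sub>H X 0 x = 0"
  using inner_add_left[of 0 0 x] zero_closed by simp

lemma inner_self_nonneg: "x \<in> space\<^sub>H X \<Longrightarrow> 0 \<le> Re (inner\<^sub>H X x x)"
  using inner_pos[of x] inner_zero[of x] by (cases "x = 0") auto

lemma Re_inner_expand:
  assumes "x \<in> space\<^sub>H X" "y \<in> space\<^sub>H X"
  defines "s \<equiv> \<lambda>r. scale\<^sub>H X (complex_of_real r) y"
  shows "Re (inner\<^sub>H X (x + s r) (x + s r)) =
    Re (inner\<^sub>H X x x) + 2 * r * Re (inner\<^sub>H X x y) + r\<^sup>2 * Re (inner\<^sub>H X y y)"
proof -
  have s: "s r \<in> space\<^sub>H X" using assms by (simp add: scale_closed Reals_scalar)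
  have xs: "x + s r \<in> space\<^sub>H X" using s assms by (simp add: add_closed)
  have sy: "inner\<^sub>H X (s r) z = of_real r * inner\<^sub>H X y z" if "z \<in> space\<^sub>H X" for z
    unfolding s_def using assms that by (simp add: inner_scale_left Reals_scalar)
  have c: "Re (inner\<^sub>H X u v) = Re (inner\<^sub>H X v u)" if "u \<in> space\<^sub>H X" "v \<in> space\<^sub>H X" for u v
    using inner_commute[OF that] by simp
  have "Re (inner\<^sub>H X (x + s r) (x + s r)) =
      Re (inner\<^sub>H X x (x + s r)) + r * Re (inner\<^sub>H X y (x + s r))"
    using inner_add_left[OF assms(1) s xs] sy[OF xs] by simp
  also have "Re (inner\<^sub>H X x (x + s r)) = Re (inner\<^sub>H X x x) + r * Re (inner\<^sub>H X x y)"
    using c[OF assms(1) xs] c[OF assms(1,2)] inner_add_left[OF assms(1) s assms(1)] sy[OF assms(1)]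
    by simp
  also have "Re (inner\<^sub>H X y (x + s r)) = Re (inner\<^sub>H X x y) + r * Re (inner\<^sub>H X y y)"
    using c[OF assms(2) xs] inner_add_left[OF assms(1) s assms(2)] sy[OF assms(2)] by simp
  finally show ?thesis by (simp add: algebra_simps power2_eq_square)
qed

lemma Re_inner_le:
  assumes "x \<in> space\<^sub>H X" "y \<in> space\<^sub>H X"
  shows "Re (inner\<^sub>H X x y) \<le> norm\<^sub>H X x * norm\<^sub>H X y"
proof -
  define a b c where "a = Re (inner\<^sub>H X x x)" and "b = Re (inner\<^sub>H X x y)"
    and "c = Re (inner\<^sub>H X y y)"
  have q: "0 \<le> a + 2 * r * b + r\<^sup>2 * c" for r
    using Re_inner_expand[OF assms, of r] assms
    by (metis a_def b_def c_def add_closed inner_self_nonneg scale_closed Reals_scalar)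
  have a: "0 \<le> a" and c: "0 \<le> c" using assms by (auto simp: a_def c_def inner_self_nonneg)
  have "b\<^sup>2 \<le> a * c"
  proof (cases "c = 0")
    case True
    have "b = 0"
    proof (rule ccontr)
      assume "b \<noteq> 0"
      then have "a + 2 * (- (a + 1) / (2 * b)) * b = -1" by (simp add: field_simps)
      then show False using q[of "- (a + 1) / (2 * b)"] True by simp
    qed
    then show ?thesis using a c by simp
  next
    case False
    have "0 \<le> c * (a + 2 * (- b / c) * b + (- b / c)\<^sup>2 * c)"
      using q[of "- b / c"] c by (intro mult_nonneg_nonneg)
    also have "\<dots> = a * c - b\<^sup>2" using False by (simp add: field_simps power2_eq_square)
    finally show ?thesis by simp
  qed
  then have "\<bar>b\<bar> \<le> sqrt (a * c)" using real_le_rsqrt[of "\<bar>b\<bar>" "a * c"] by simp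
  then show ?thesis by (simp add: norm\<^sub>H_def real_sqrt_mult a_def b_def c_def)
qed

lemma norm_triangle:
  assumes "x \<in> space\<^sub>H X" "y \<in> space\<^sub>H X"
  shows "norm\<^sub>H X (x + y) \<le> norm\<^sub>H X x + norm\<^sub>H X y"
proof -
  have "(norm\<^sub>H X (x + y))\<^sup>2 = (norm\<^sub>H X x)\<^sup>2 + 2 * Re (inner\<^sub>H X x y) + (norm\<^sub>H X y)\<^sup>2"
    using Re_inner_expand[OF assms, of 1] scale_one[OF assms(2)]
      inner_self_nonneg[OF add_closed[OF assms]] assms
    by (simp add: norm\<^sub>H_def inner_self_nonneg)
  also have "\<dots> \<le> (norm\<^sub>H X x + norm\<^sub>H X y)\<^sup>2"
    using Re_inner_le[OF assms] by (simp add: power2_sum)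
  finally show ?thesis
    by (rule power2_le_imp_le) (simp add: norm\<^sub>H_def assms inner_self_nonneg)
qed

lemma norm_minus:
  assumes "x \<in> space\<^sub>H X" shows "norm\<^sub>H X (- x) = norm\<^sub>H X x"
proof -
  have "Re (inner\<^sub>H X (0 + scale\<^sub>H X (of_real (-1)) x) (0 + scale\<^sub>H X (of_real (-1)) x)) =
      Re (inner\<^sub>H X x x)"
    using Re_inner_expand[OF zero_closed assms, of "-1"] assms zero_closed
    by (simp add: inner_zero)
  then show ?thesis using scale_minus_one[OF assms] by (simp add: norm\<^sub>H_def)
qed

sublocale metric: Metric_space "space\<^sub>H X" "dist\<^sub>H X"
proof
  fix x y
  show "0 \<le> dist\<^sub>H X x y" by (simp add: dist\<^sub>H_def norm\<^sub>H_def diff_closed inner_self_nonneg)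
  show "dist\<^sub>H X x y = dist\<^sub>H X y x"
    using norm_minus[OF diff_closed, of x y] by (simp add: dist\<^sub>H_def)
next
  fix x y assume xy: "x \<in> space\<^sub>H X" "y \<in> space\<^sub>H X"
  show "dist\<^sub>H X x y = 0 \<longleftrightarrow> x = y"
    using xy inner_pos[OF diff_closed[OF xy]] inner_zero[OF zero_closed]
    by (cases "x = y") (simp_all add: dist\<^sub>H_def norm\<^sub>H_def)
next
  fix x y z assume "x \<in> space\<^sub>H X" "y \<in> space\<^sub>H X" "z \<in> space\<^sub>H X"
  then show "dist\<^sub>H X x z \<le> dist\<^sub>H X x y + dist\<^sub>H X y z"
    using norm_triangle[of "x - y" "y - z"] by (simp add: dist\<^sub>H_def diff_closed)
qed

end

definition span\<^sub>H :: "complex set \<Rightarrow> 'a::ab_group_add hilbert \<Rightarrow> 'a set \<Rightarrow> 'a set" where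
  "span\<^sub>H K X B = {\<Sum>b\<in>F. scale\<^sub>H X (c b) b | F c. finite F \<and> F \<subseteq> B \<and> c \<in> F \<rightarrow> K}"

definition finite_basis :: "complex set \<Rightarrow> 'a::ab_group_add hilbert \<Rightarrow> 'a set \<Rightarrow> 'a set \<Rightarrow> bool" where
  "finite_basis K X V B \<longleftrightarrow> finite B \<and> B \<subseteq> V \<and>
     (\<forall>v\<in>V. \<exists>!c. c \<in> B \<rightarrow>\<^sub>E K \<and> v = (\<Sum>b\<in>B. scale\<^sub>H X (c b) b))"

definition bounded_op ::
  "complex set \<Rightarrow> 'a::ab_group_add hilbert \<Rightarrow> 'b::ab_group_add hilbert \<Rightarrow> ('a \<Rightarrow> 'b) \<Rightarrow> bool" where
  "bounded_op K X Y A \<longleftrightarrow> A \<in> space\<^sub>H X \<rightarrow> space\<^sub>H Y \<and>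
     (\<forall>x\<in>space\<^sub>H X. \<forall>y\<in>space\<^sub>H X. A (x + y) = A x + A y) \<and>
     (\<forall>a\<in>K. \<forall>x\<in>space\<^sub>H X. A (scale\<^sub>H X a x) = scale\<^sub>H Y a (A x)) \<and>
     (\<exists>C. \<forall>x\<in>space\<^sub>H X. norm\<^sub>H Y (A x) \<le> C * norm\<^sub>H X x)"

definition unit_ball :: "'a::ab_group_add hilbert \<Rightarrow> 'a set" where
  "unit_ball X = {x \<in> space\<^sub>H X. norm\<^sub>H X x \<le> 1}"

definition op_norm ::
  "'a::ab_group_add hilbert \<Rightarrow> 'b::ab_group_add hilbert \<Rightarrow> ('a \<Rightarrow> 'b) \<Rightarrow> real" where
  "op_norm X Y A = (SUP x\<in>unit_ball X. norm\<^sub>H Y (A x))"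

definition compact_op ::
  "complex set \<Rightarrow> 'a::ab_group_add hilbert \<Rightarrow> 'b::ab_group_add hilbert \<Rightarrow> ('a \<Rightarrow> 'b) \<Rightarrow> bool" where
  "compact_op K X Y A \<longleftrightarrow> bounded_op K X Y A \<and>
     compactin (topology\<^sub>H Y) (topology\<^sub>H Y closure_of (A ` unit_ball X))"

text \<open>The rank is the dimension of the range; it is \<open>\<infinity>\<close> if there is no finite basis.\<close>

definition op_rank ::
  "complex set \<Rightarrow> 'a::ab_group_add hilbert \<Rightarrow> 'b::ab_group_add hilbert \<Rightarrow> ('a \<Rightarrow> 'b) \<Rightarrow> enat" where
  "op_rank K X Y A = (INF B\<in>{B. finite_basis K Y (A ` space\<^sub>H X) B}. enat (card B))"

text \<open>Only used for \<open>n \<ge> 1\<close>; for \<open>n = 0\<close> the infimum ranges over the empty set.\<close>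

definition approx_number ::
  "complex set \<Rightarrow> 'a::ab_group_add hilbert \<Rightarrow> 'b::ab_group_add hilbert \<Rightarrow> ('a \<Rightarrow> 'b) \<Rightarrow> nat \<Rightarrow> real" where
  "approx_number K X Y T n =
     (INF A\<in>{A. bounded_op K X Y A \<and> op_rank K X Y A < enat n}. op_norm X Y (\<lambda>x. T x - A x))"

text \<open>
  \<open>(H, \<tau>)\<close> is a \<open>d\<close>-fold Hilbert space tensor power of \<open>X\<close>, where \<open>\<tau> f\<close> is the elementary
  tensor of \<open>f 0, \<dots>, f (d - 1)\<close>.  The two conditions on \<open>\<tau>\<close> (inner products of elementary tensors
  are products of inner products, and elementary tensors span a dense subspace) imply that
  \<open>\<tau>\<close> is multilinear, and they determine \<open>(H, \<tau>)\<close> up to a unique unitary map.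
\<close>

definition tensor_power ::
  "complex set \<Rightarrow> nat \<Rightarrow> 'a::ab_group_add hilbert \<Rightarrow> 'c::ab_group_add hilbert
    \<Rightarrow> ((nat \<Rightarrow> 'a) \<Rightarrow> 'c) \<Rightarrow> bool" where
  "tensor_power K d X H \<tau> \<longleftrightarrow> hilbert_space K H \<and>
     \<tau> \<in> ({..<d} \<rightarrow> space\<^sub>H X) \<rightarrow> space\<^sub>H H \<and>
     (\<forall>f\<in>{..<d} \<rightarrow> space\<^sub>H X. \<forall>g\<in>{..<d} \<rightarrow> space\<^sub>H X.
        inner\<^sub>H H (\<tau> f) (\<tau> g) = (\<Prod>i<d. inner\<^sub>H X (f i) (g i))) \<and>
     topology\<^sub>H H closure_of span\<^sub>H K H (\<tau> ` ({..<d} \<rightarrow> space\<^sub>H X)) = space\<^sub>H H"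

text \<open>
  \<open>S\<close> is the \<open>d\<close>th tensor power of the operator \<open>T\<close> on \<open>X\<close>, between the tensor powers
  \<open>(G, \<sigma>)\<close> of the domain and \<open>(H, \<tau>)\<close> of the codomain of \<open>T\<close>.
\<close>

definition tensor_power_op ::
  "complex set \<Rightarrow> nat \<Rightarrow> 'a::ab_group_add hilbert \<Rightarrow> ('a \<Rightarrow> 'b::ab_group_add)
    \<Rightarrow> 'c::ab_group_add hilbert \<Rightarrow> ((nat \<Rightarrow> 'a) \<Rightarrow> 'c)
    \<Rightarrow> 'e::ab_group_add hilbert \<Rightarrow> ((nat \<Rightarrow> 'b) \<Rightarrow> 'e) \<Rightarrow> ('c \<Rightarrow> 'e) \<Rightarrow> bool" where
  "tensor_power_op K d X T G \<sigma> H \<tau> S \<longleftrightarrow> bounded_op K G H S \<and>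
     (\<forall>f\<in>{..<d} \<rightarrow> space\<^sub>H X. S (\<sigma> f) = \<tau> (\<lambda>i. T (f i)))"

definition decays_polynomially :: "(nat \<Rightarrow> real) \<Rightarrow> bool" where
  "decays_polynomially x \<longleftrightarrow>
     (\<exists>C>0. \<exists>p>0. \<forall>m\<ge>1. x m \<le> C * real m powr (- p))"

definition min_error ::
  "complex set \<Rightarrow> 'a::ab_group_add hilbert \<Rightarrow> 'b::ab_group_add hilbert \<Rightarrow> ('a \<Rightarrow> 'b) \<Rightarrow> nat \<Rightarrow> real" where
  "min_error K X Y S n = approx_number K X Y S (n + 1)"

text \<open>The minimum exists for compact \<open>S\<close> and \<open>\<epsilon> > 0\<close>, since then the errors tend to \<open>0\<close>.\<close>

definition information_complexity ::
  "complex set \<Rightarrow> 'a::ab_group_add hilbert \<Rightarrow> 'b::ab_group_add hilbert \<Rightarrow> ('a \<Rightarrow> 'b) \<Rightarrow> real \<Rightarrow> nat" where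
  "information_complexity K X Y S \<epsilon> = (LEAST n. min_error K X Y S n < \<epsilon>)"

text \<open>Tractability of a problem with information complexity \<open>N \<epsilon> d\<close>.\<close>

definition polynomially_tractable :: "(real \<Rightarrow> nat \<Rightarrow> nat) \<Rightarrow> bool" where
  "polynomially_tractable N \<longleftrightarrow>
     (\<exists>C\<ge>0. \<exists>p\<ge>0. \<exists>q\<ge>0. \<forall>d\<ge>1. \<forall>\<epsilon>>0. real (N \<epsilon> d) \<le> C * \<epsilon> powr (- q) * real d powr p)"

definition strongly_polynomially_tractable :: "(real \<Rightarrow> nat \<Rightarrow> nat) \<Rightarrow> bool" where
  "strongly_polynomially_tractable N \<longleftrightarrow>
     (\<exists>C\<ge>0. \<exists>q\<ge>0. \<forall>d\<ge>1. \<forall>\<epsilon>>0. real (N \<epsilon> d) \<le> C * \<epsilon> powr (- q))"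

end

theory Submission
  imports Defs
begin

text \<open>
  The greedy singular system \<open>e\<^sub>0, e\<^sub>1, \<dots>\<close> of a compact operator \<open>T\<close> has \<open>\<parallel>T e\<^sub>n\<parallel> = a\<^bsub>n+1\<^esub>(T)\<close>,
  and the products of the \<open>e\<^sub>i\<close> form a singular system of the tensor power, whose singular values
  are the products of \<open>d\<close> singular values of \<open>T\<close>.

  Tractability implies decay: choosing \<open>k\<close> of the \<open>d\<close> factors gives \<open>d choose k\<close> singular values
  equal to \<open>a\<^sub>2(T\<^sub>d)\<^sup>k\<close>, so \<open>n(a\<^sub>2(T\<^sub>d)\<^sup>k, d) \<ge> (d/k)\<^sup>k\<close>.  If \<open>n(\<epsilon>, d) \<le> C \<epsilon>\<^bsup>-q\<^esup> d\<^bsup>p\<^esup>\<close>, then any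
  \<open>k > p\<close> yields a polynomial bound on \<open>a\<^sub>2(T\<^sub>d)\<close>.

  Decay implies strong tractability: \<open>a\<^sub>n(T\<^sub>d)\<close> is at most a constant times both \<open>n\<^bsup>-p\<^sub>1\<^esup>\<close> and
  (for \<open>n \<ge> 2\<close>) \<open>d\<^bsup>-p\<^sub>2\<^esup>\<close>.  Hence for \<open>r = 2/p\<^sub>1 + 1/p\<^sub>2\<close> the sum of \<open>a\<^sub>n(T\<^sub>d)\<^sup>r\<close> over \<open>n\<close> is at most
  \<open>1 + c/d\<close>.  Its \<open>d\<close>th power, which bounds \<open>\<delta>\<^sup>r\<close> times the number of products exceeding \<open>\<delta>\<close>, is
  at most \<open>e\<^sup>c\<close>.
\<close>

section \<open>Hilbert spaces\<close>

context hilbert_space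
begin

section \<open>Algebra of scalars and inner products\<close>

lemma scalar_ops [simp, intro]:
  "0 \<in> K" "1 \<in> K"
  "\<lbrakk>a \<in> K; b \<in> K\<rbrakk> \<Longrightarrow> a + b \<in> K" "\<lbrakk>a \<in> K; b \<in> K\<rbrakk> \<Longrightarrow> a - b \<in> K"
  "\<lbrakk>a \<in> K; b \<in> K\<rbrakk> \<Longrightarrow> a * b \<in> K" "\<lbrakk>a \<in> K; b \<in> K\<rbrakk> \<Longrightarrow> a / b \<in> K"
  "a \<in> K \<Longrightarrow> - a \<in> K" "a \<in> K \<Longrightarrow> cnj a \<in> K" "complex_of_real r \<in> K"
  using field by (auto elim!: Reals_cases)

lemma scalar_sum [intro]: "(\<And>i. i \<in> I \<Longrightarrow> a i \<in> K) \<Longrightarrow> sum a I \<in> K"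
  by (induction I rule: infinite_finite_induct) auto

declare zero_closed [simp, intro] add_closed [simp, intro] diff_closed [simp, intro]
  scale_closed [simp, intro] minus_closed [simp, intro] inner_scalar [simp, intro]

lemma sum_closed [simp, intro]: "(\<And>i. i \<in> I \<Longrightarrow> f i \<in> space\<^sub>H X) \<Longrightarrow> sum f I \<in> space\<^sub>H X"
  by (induction I rule: infinite_finite_induct) auto

lemma scale_zero_left [simp]: "x \<in> space\<^sub>H X \<Longrightarrow> scale\<^sub>H X 0 x = 0"
  using scale_add_left[of 0 0 x] by simp

lemma scale_zero_right [simp]: "a \<in> K \<Longrightarrow> scale\<^sub>H X a 0 = 0"
  using scale_add_right[of a 0 0] by simp

lemma scale_sum_right:
  "\<lbrakk>a \<in> K; \<And>i. i \<in> I \<Longrightarrow> f i \<in> space\<^sub>H X\<rbrakk> \<Longrightarrow>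
    scale\<^sub>H X a (\<Sum>i\<in>I. f i) = (\<Sum>i\<in>I. scale\<^sub>H X a (f i))"
  by (induction I rule: infinite_finite_induct) (auto simp: scale_add_right sum_closed)

lemma scale_diff_right:
  assumes "a \<in> K" "x \<in> space\<^sub>H X" "y \<in> space\<^sub>H X"
  shows "scale\<^sub>H X a (x - y) = scale\<^sub>H X a x - scale\<^sub>H X a y"
  using scale_add_right[of a "x - y" y] assms by (simp add: algebra_simps diff_closed)

lemma inner_add_right:
  assumes "x \<in> space\<^sub>H X" "y \<in> space\<^sub>H X" "z \<in> space\<^sub>H X"
  shows "inner\<^sub>H X z (x + y) = inner\<^sub>H X z x + inner\<^sub>H X z y"
  using assms inner_commute[of z "x + y"] inner_commute[of z x] inner_commute[of z y]
  by (simp add: inner_add_left add_closed)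

lemma inner_scale_right:
  assumes "a \<in> K" "x \<in> space\<^sub>H X" "y \<in> space\<^sub>H X"
  shows "inner\<^sub>H X y (scale\<^sub>H X a x) = cnj a * inner\<^sub>H X y x"
  using assms inner_commute[of y "scale\<^sub>H X a x"] inner_commute[of y x]
  by (simp add: inner_scale_left scale_closed)

lemma inner_zero_right: "x \<in> space\<^sub>H X \<Longrightarrow> inner\<^sub>H X x 0 = 0"
  using inner_add_right[of 0 0 x] by simp

lemma inner_diff_left:
  assumes "x \<in> space\<^sub>H X" "y \<in> space\<^sub>H X" "z \<in> space\<^sub>H X"
  shows "inner\<^sub>H X (x - y) z = inner\<^sub>H X x z - inner\<^sub>H X y z"
  using inner_add_left[of "x - y" y z] assms by (simp add: algebra_simps diff_closed)

lemma inner_diff_right: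
  assumes "x \<in> space\<^sub>H X" "y \<in> space\<^sub>H X" "z \<in> space\<^sub>H X"
  shows "inner\<^sub>H X z (x - y) = inner\<^sub>H X z x - inner\<^sub>H X z y"
  using inner_add_right[of "x - y" y z] assms by (simp add: algebra_simps diff_closed)

lemma inner_sum_left:
  "\<lbrakk>\<And>i. i \<in> I \<Longrightarrow> f i \<in> space\<^sub>H X; y \<in> space\<^sub>H X\<rbrakk> \<Longrightarrow>
    inner\<^sub>H X (\<Sum>i\<in>I. f i) y = (\<Sum>i\<in>I. inner\<^sub>H X (f i) y)"
  by (induction I rule: infinite_finite_induct) (auto simp: inner_zero inner_add_left sum_closed)

lemma inner_sum_right:
  "\<lbrakk>\<And>i. i \<in> I \<Longrightarrow> f i \<in> space\<^sub>H X; y \<in> space\<^sub>H X\<rbrakk> \<Longrightarrow>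
    inner\<^sub>H X y (\<Sum>i\<in>I. f i) = (\<Sum>i\<in>I. inner\<^sub>H X y (f i))"
  by (induction I rule: infinite_finite_induct)
    (auto simp: inner_zero_right inner_add_right sum_closed)

section \<open>Norm, Cauchy-Schwarz inequality and parallelogram law\<close>

lemma norm_nonneg [simp]: "x \<in> space\<^sub>H X \<Longrightarrow> 0 \<le> norm\<^sub>H X x"
  by (simp add: norm\<^sub>H_def inner_self_nonneg)

lemma norm_zero [simp]: "norm\<^sub>H X 0 = 0"
  by (simp add: norm\<^sub>H_def inner_zero)

lemma inner_self: "x \<in> space\<^sub>H X \<Longrightarrow> inner\<^sub>H X x x = of_real ((norm\<^sub>H X x)\<^sup>2)"
  using inner_commute[of x x] by (simp add: norm\<^sub>H_def inner_self_nonneg complex_eq_iff)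

lemma norm_square: "x \<in> space\<^sub>H X \<Longrightarrow> (norm\<^sub>H X x)\<^sup>2 = Re (inner\<^sub>H X x x)"
  by (simp add: inner_self)

lemma norm_eq_zero_iff: "x \<in> space\<^sub>H X \<Longrightarrow> norm\<^sub>H X x = 0 \<longleftrightarrow> x = 0"
  using inner_pos[of x] by (cases "x = 0") (auto simp: norm\<^sub>H_def inner_zero)

lemma norm_pos: "\<lbrakk>x \<in> space\<^sub>H X; x \<noteq> 0\<rbrakk> \<Longrightarrow> 0 < norm\<^sub>H X x"
  using norm_nonneg[of x] norm_eq_zero_iff[of x] by (simp add: order_less_le)

lemma norm_scale:
  assumes "a \<in> K" "x \<in> space\<^sub>H X"
  shows "norm\<^sub>H X (scale\<^sub>H X a x) = cmod a * norm\<^sub>H X x"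
proof -
  have "inner\<^sub>H X (scale\<^sub>H X a x) (scale\<^sub>H X a x) = a * (cnj a * inner\<^sub>H X x x)"
    using assms by (simp add: inner_scale_left inner_scale_right)
  then have "(norm\<^sub>H X (scale\<^sub>H X a x))\<^sup>2 = Re (a * (cnj a * of_real ((norm\<^sub>H X x)\<^sup>2)))"
    using assms by (subst norm_square) (simp_all add: inner_self[of x])
  also have "\<dots> = (cmod a * norm\<^sub>H X x)\<^sup>2"
    by (simp only: mult.assoc[symmetric] complex_norm_square[symmetric] of_real_mult[symmetric]
        Re_complex_of_real power_mult_distrib)
  finally show ?thesis
    by (rule power2_eq_imp_eq) (use assms in auto)
qed

text \<open>The real-part bound \<open>Re_inner_le\<close> is applied after multiplying
  \<open>x\<close> by a scalar of modulus one that makes the inner product real and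
  nonnegative.\<close>

lemma norm_inner_le:
  assumes "x \<in> space\<^sub>H X" "y \<in> space\<^sub>H X"
  shows "cmod (inner\<^sub>H X x y) \<le> norm\<^sub>H X x * norm\<^sub>H X y"
proof (cases "inner\<^sub>H X x y = 0")
  case False
  define w where "w = inner\<^sub>H X x y"
  \<comment> \<open>The rotating scalar: \<open>a * w\<close> equals the modulus of
    \<open>w\<close>. It lies in \<open>K\<close> in both cases, because \<open>K\<close> contains
    the reals and is closed under conjugation and division.\<close>
  define a where "a = cnj w / of_real (cmod w)"
  have aK: "a \<in> K" unfolding a_def w_def using assms by auto
  have w: "w \<noteq> 0" using False by (simp add: w_def)
  have "a * w = of_real (cmod w)"
    using w by (simp add: a_def complex_norm_square[symmetric] power2_eq_square mult.commute)
  then have "cmod w = Re (inner\<^sub>H X (scale\<^sub>H X a x) y)"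
    using assms aK by (simp add: inner_scale_left w_def)
  also have "\<dots> \<le> norm\<^sub>H X (scale\<^sub>H X a x) * norm\<^sub>H X y"
    using assms aK by (intro Re_inner_le) auto
  also have "norm\<^sub>H X (scale\<^sub>H X a x) = norm\<^sub>H X x"
    using assms aK w by (simp add: norm_scale a_def norm_divide)
  finally show ?thesis by (simp add: w_def)
qed (use assms in auto)

lemma norm_diff_commute:
  "\<lbrakk>x \<in> space\<^sub>H X; y \<in> space\<^sub>H X\<rbrakk> \<Longrightarrow> norm\<^sub>H X (x - y) = norm\<^sub>H X (y - x)"
  using norm_minus[of "x - y"] by (simp add: diff_closed)

lemma norm_diff_triangle:
  "\<lbrakk>x \<in> space\<^sub>H X; y \<in> space\<^sub>H X\<rbrakk> \<Longrightarrow> norm\<^sub>H X x \<le> norm\<^sub>H X y + norm\<^sub>H X (x - y)"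
  using norm_triangle[of y "x - y"] by (simp add: diff_closed)

lemma norm_add_square:
  assumes "x \<in> space\<^sub>H X" "y \<in> space\<^sub>H X"
  shows "(norm\<^sub>H X (x + y))\<^sup>2 = (norm\<^sub>H X x)\<^sup>2 + 2 * Re (inner\<^sub>H X x y) + (norm\<^sub>H X y)\<^sup>2"
  using Re_inner_expand[OF assms, of 1] scale_one[OF assms(2)] assms
  by (simp add: norm_square add_closed)

text \<open>The cross terms cancel. The identity is needed in domain and codomain at once, to show
  that a maximising sequence of an operator converges.\<close>

lemma parallelogram:
  assumes "x \<in> space\<^sub>H X" "y \<in> space\<^sub>H X"
  shows "(norm\<^sub>H X (x + y))\<^sup>2 + (norm\<^sub>H X (x - y))\<^sup>2 = 2 * (norm\<^sub>H X x)\<^sup>2 + 2 * (norm\<^sub>H X y)\<^sup>2"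
proof -
  have "inner\<^sub>H X x (- y) = - inner\<^sub>H X x y"
    using inner_diff_right[of 0 y x] assms by (simp add: inner_zero_right)
  then show ?thesis
    using norm_add_square[OF assms] norm_add_square[of x "- y"] assms
    by (simp add: minus_closed norm_minus)
qed

lemma pythagoras:
  assumes "x \<in> space\<^sub>H X" "y \<in> space\<^sub>H X" "inner\<^sub>H X x y = 0"
  shows "(norm\<^sub>H X (x + y))\<^sup>2 = (norm\<^sub>H X x)\<^sup>2 + (norm\<^sub>H X y)\<^sup>2"
  using norm_add_square[of x y] assms by simp

section \<open>Convergence, completeness and density in terms of the norm\<close>

lemma limitin_iff_norm:
  assumes "\<And>n. f n \<in> space\<^sub>H X"
  shows "limitin (topology\<^sub>H X) f l sequentially \<longleftrightarrow>
    l \<in> space\<^sub>H X \<and> (\<lambda>n. norm\<^sub>H X (f n - l)) \<longlonglongrightarrow> 0"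
  using assms
  by (auto simp: metric.limit_metric_sequentially LIMSEQ_iff dist\<^sub>H_def diff_closed)

lemma MCauchy_iff_norm:
  assumes "\<And>n. f n \<in> space\<^sub>H X"
  shows "metric.MCauchy f \<longleftrightarrow>
    (\<forall>\<epsilon>>0. \<exists>N. \<forall>m\<ge>N. \<forall>n\<ge>N. norm\<^sub>H X (f m - f n) < \<epsilon>)"
  using assms by (auto simp: metric.MCauchy_def dist\<^sub>H_def image_subset_iff)

lemma Cauchy_limit:
  assumes "\<And>n. f n \<in> space\<^sub>H X"
    and "\<And>\<epsilon>. 0 < \<epsilon> \<Longrightarrow> \<exists>N. \<forall>m\<ge>N. \<forall>n\<ge>N. norm\<^sub>H X (f m - f n) < \<epsilon>"
  obtains l where "l \<in> space\<^sub>H X" "(\<lambda>n. norm\<^sub>H X (f n - l)) \<longlonglongrightarrow> 0"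
proof -
  have "metric.MCauchy f" using assms by (simp add: MCauchy_iff_norm)
  then obtain l where "limitin (topology\<^sub>H X) f l sequentially"
    using complete unfolding metric.mcomplete_def by blast
  then show thesis
    using that assms(1) limitin_iff_norm by blast
qed

lemma dense_approx:
  assumes "topology\<^sub>H X closure_of S = space\<^sub>H X" "x \<in> space\<^sub>H X" "0 < r"
  obtains y where "y \<in> S" "y \<in> space\<^sub>H X" "norm\<^sub>H X (x - y) < r"
proof -
  obtain y where "y \<in> S" "y \<in> metric.mball x r"
    using assms unfolding metric.metric_closure_of by blast
  then show thesis using that by (auto simp: dist\<^sub>H_def)
qed

end

section \<open>Orthonormal systems\<close>

text \<open>
  Zero vectors are admitted so that singular systems of operators of finite rank are also
  indexed by all natural numbers.
\<close>

definition orthonormal_or_zero :: "'a::ab_group_add hilbert \<Rightarrow> 'i set \<Rightarrow> ('i \<Rightarrow> 'a) \<Rightarrow> bool" where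
  "orthonormal_or_zero X I e \<longleftrightarrow>
     (\<forall>i\<in>I. e i \<in> space\<^sub>H X \<and> (e i = 0 \<or> norm\<^sub>H X (e i) = 1)) \<and>
     (\<forall>i\<in>I. \<forall>j\<in>I. i \<noteq> j \<longrightarrow> inner\<^sub>H X (e i) (e j) = 0)"

text \<open>For finite \<open>I\<close> and an \<open>orthonormal_or_zero\<close> system this is the
  orthogonal projection onto the span of the system; zero members contribute nothing.\<close>

definition proj\<^sub>H :: "'a::ab_group_add hilbert \<Rightarrow> 'i set \<Rightarrow> ('i \<Rightarrow> 'a) \<Rightarrow> 'a \<Rightarrow> 'a" where
  "proj\<^sub>H X I e x = (\<Sum>i\<in>I. scale\<^sub>H X (inner\<^sub>H X x (e i)) (e i))"

context hilbert_space
begin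

text \<open>Stated for orthogonal vectors of arbitrary length, because it is also applied to the
  images \<open>T (e i)\<close>, whose lengths are the singular values.\<close>

lemma inner_lincomb_orthogonal:
  assumes "finite I" "\<And>i. i \<in> I \<Longrightarrow> c i \<in> K" "\<And>i. i \<in> I \<Longrightarrow> e i \<in> space\<^sub>H X"
    and "\<And>i j. \<lbrakk>i \<in> I; j \<in> I; i \<noteq> j\<rbrakk> \<Longrightarrow> inner\<^sub>H X (e i) (e j) = 0" and "j \<in> I"
  shows "inner\<^sub>H X (\<Sum>i\<in>I. scale\<^sub>H X (c i) (e i)) (e j) = c j * inner\<^sub>H X (e j) (e j)"
proof -
  have "inner\<^sub>H X (\<Sum>i\<in>I. scale\<^sub>H X (c i) (e i)) (e j) = (\<Sum>i\<in>I. c i * inner\<^sub>H X (e i) (e j))"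
    using assms by (subst inner_sum_left) (auto simp: inner_scale_left)
  also have "\<dots> = (\<Sum>i\<in>I. if i = j then c j * inner\<^sub>H X (e j) (e j) else 0)"
    using assms by (intro sum.cong) auto
  finally have "inner\<^sub>H X (\<Sum>i\<in>I. scale\<^sub>H X (c i) (e i)) (e j)
      = (\<Sum>i\<in>I. if i = j then c j * inner\<^sub>H X (e j) (e j) else 0)" .
  then show ?thesis using assms by simp
qed

lemma norm_lincomb_orthogonal:
  assumes "finite I" "\<And>i. i \<in> I \<Longrightarrow> c i \<in> K" "\<And>i. i \<in> I \<Longrightarrow> e i \<in> space\<^sub>H X"
    and "\<And>i j. \<lbrakk>i \<in> I; j \<in> I; i \<noteq> j\<rbrakk> \<Longrightarrow> inner\<^sub>H X (e i) (e j) = 0"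
  shows "(norm\<^sub>H X (\<Sum>i\<in>I. scale\<^sub>H X (c i) (e i)))\<^sup>2 = (\<Sum>i\<in>I. (cmod (c i))\<^sup>2 * (norm\<^sub>H X (e i))\<^sup>2)"
  using assms
proof (induction I rule: finite_induct)
  case (insert k I)
  let ?S = "\<Sum>i\<in>I. scale\<^sub>H X (c i) (e i)"
  have S: "?S \<in> space\<^sub>H X" using insert.prems by (intro sum_closed scale_closed) auto
  have "inner\<^sub>H X ?S (e k) = (\<Sum>i\<in>I. c i * inner\<^sub>H X (e i) (e k))"
    using insert.prems by (subst inner_sum_left) (auto simp: inner_scale_left)
  also have "\<dots> = 0" using insert by (intro sum.neutral) auto
  finally have "inner\<^sub>H X ?S (scale\<^sub>H X (c k) (e k)) = 0"
    using S insert.prems by (simp add: inner_scale_right)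
  then have "(norm\<^sub>H X (?S + scale\<^sub>H X (c k) (e k)))\<^sup>2 = (norm\<^sub>H X ?S)\<^sup>2 + (norm\<^sub>H X (scale\<^sub>H X (c k) (e k)))\<^sup>2"
    using S insert.prems by (intro pythagoras) auto
  moreover have "(norm\<^sub>H X ?S)\<^sup>2 = (\<Sum>i\<in>I. (cmod (c i))\<^sup>2 * (norm\<^sub>H X (e i))\<^sup>2)"
    by (rule insert.IH) (use insert.prems in auto)
  moreover have "norm\<^sub>H X (scale\<^sub>H X (c k) (e k)) = cmod (c k) * norm\<^sub>H X (e k)"
    using insert.prems by (simp add: norm_scale)
  ultimately show ?case
    by (simp only: sum.insert[OF insert.hyps] add.commute[of "scale\<^sub>H X (c k) (e k)"]
        power_mult_distrib)
qed simp

lemma proj_closed: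
  "\<lbrakk>orthonormal_or_zero X I e; x \<in> space\<^sub>H X\<rbrakk> \<Longrightarrow> proj\<^sub>H X I e x \<in> space\<^sub>H X"
  unfolding proj\<^sub>H_def orthonormal_or_zero_def by (intro sum_closed scale_closed) auto

lemma inner_proj:
  assumes "orthonormal_or_zero X I e" "finite I" "x \<in> space\<^sub>H X" "j \<in> I"
  shows "inner\<^sub>H X (proj\<^sub>H X I e x) (e j) = inner\<^sub>H X x (e j)"
proof -
  have "inner\<^sub>H X (proj\<^sub>H X I e x) (e j) = inner\<^sub>H X x (e j) * inner\<^sub>H X (e j) (e j)"
    unfolding proj\<^sub>H_def using assms
    by (intro inner_lincomb_orthogonal) (auto simp: orthonormal_or_zero_def)
  then show ?thesis
    using assms by (auto simp: orthonormal_or_zero_def inner_self inner_zero_right)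
qed

lemma inner_residual:
  assumes "orthonormal_or_zero X I e" "finite I" "x \<in> space\<^sub>H X" "j \<in> I"
  shows "inner\<^sub>H X (x - proj\<^sub>H X I e x) (e j) = 0"
  using inner_proj[OF assms] assms proj_closed[OF assms(1,3)]
  by (simp add: inner_diff_left orthonormal_or_zero_def)

lemma norm_proj_square:
  assumes "orthonormal_or_zero X I e" "finite I" "x \<in> space\<^sub>H X"
  shows "(norm\<^sub>H X (proj\<^sub>H X I e x))\<^sup>2 = (\<Sum>i\<in>I. (cmod (inner\<^sub>H X x (e i)))\<^sup>2)"
proof -
  have "(norm\<^sub>H X (proj\<^sub>H X I e x))\<^sup>2
      = (\<Sum>i\<in>I. (cmod (inner\<^sub>H X x (e i)))\<^sup>2 * (norm\<^sub>H X (e i))\<^sup>2)"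
    unfolding proj\<^sub>H_def using assms
    by (intro norm_lincomb_orthogonal) (auto simp: orthonormal_or_zero_def)
  also have "\<dots> = (\<Sum>i\<in>I. (cmod (inner\<^sub>H X x (e i)))\<^sup>2)"
    using assms by (intro sum.cong) (auto simp: orthonormal_or_zero_def inner_zero_right)
  finally show ?thesis .
qed

text \<open>The residual is orthogonal to every \<open>e i\<close>, hence to the projection, and
  Pythagoras applies. Both contraction bounds in \<open>bessel\<close> follow.\<close>

lemma norm_proj_residual:
  assumes "orthonormal_or_zero X I e" "finite I" "x \<in> space\<^sub>H X"
  shows "(norm\<^sub>H X x)\<^sup>2 = (norm\<^sub>H X (proj\<^sub>H X I e x))\<^sup>2 + (norm\<^sub>H X (x - proj\<^sub>H X I e x))\<^sup>2"
proof -
  let ?p = "proj\<^sub>H X I e x"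
  have p: "?p \<in> space\<^sub>H X" using assms by (simp add: proj_closed)
  have e: "e i \<in> space\<^sub>H X" if "i \<in> I" for i using assms that by (simp add: orthonormal_or_zero_def)
  have "inner\<^sub>H X y ?p = (\<Sum>i\<in>I. cnj (inner\<^sub>H X x (e i)) * inner\<^sub>H X y (e i))"
    if "y \<in> space\<^sub>H X" for y
    unfolding proj\<^sub>H_def using assms e that
    by (subst inner_sum_right) (auto simp: inner_scale_right inner_scalar)
  then have "inner\<^sub>H X (x - ?p) ?p = (\<Sum>i\<in>I. cnj (inner\<^sub>H X x (e i)) * inner\<^sub>H X (x - ?p) (e i))"
    using assms p by (simp add: diff_closed)
  also have "\<dots> = 0" using inner_residual[OF assms] by simp
  finally show ?thesis
    using pythagoras[of "x - ?p" ?p] assms p by (simp add: diff_closed)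
qed

lemma bessel:
  assumes "orthonormal_or_zero X I e" "finite I" "x \<in> space\<^sub>H X"
  shows "norm\<^sub>H X (proj\<^sub>H X I e x) \<le> norm\<^sub>H X x" "norm\<^sub>H X (x - proj\<^sub>H X I e x) \<le> norm\<^sub>H X x"
  by (rule power2_le_imp_le; use norm_proj_residual[OF assms] assms(3) in simp)+

lemma proj_add:
  assumes "orthonormal_or_zero X I e" "x \<in> space\<^sub>H X" "y \<in> space\<^sub>H X"
  shows "proj\<^sub>H X I e (x + y) = proj\<^sub>H X I e x + proj\<^sub>H X I e y"
  unfolding proj\<^sub>H_def sum.distrib[symmetric] using assms
  by (intro sum.cong refl) (auto simp: orthonormal_or_zero_def inner_add_left scale_add_left inner_scalar)

lemma proj_scale:
  assumes "orthonormal_or_zero X I e" "x \<in> space\<^sub>H X" "a \<in> K"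
  shows "proj\<^sub>H X I e (scale\<^sub>H X a x) = scale\<^sub>H X a (proj\<^sub>H X I e x)"
  unfolding proj\<^sub>H_def using assms
  by (subst scale_sum_right)
    (auto simp: orthonormal_or_zero_def inner_scale_left scale_scale inner_scalar intro!: sum.cong)

end

section \<open>Approximation numbers\<close>

context hilbert_space
begin

section \<open>Finite bases and homogeneous linear systems\<close>

lemma scale_sum_left:
  "\<lbrakk>x \<in> space\<^sub>H X; \<And>i. i \<in> I \<Longrightarrow> a i \<in> K\<rbrakk> \<Longrightarrow>
    scale\<^sub>H X (\<Sum>i\<in>I. a i) x = (\<Sum>i\<in>I. scale\<^sub>H X (a i) x)"
  by (induction I rule: infinite_finite_induct) (auto simp: scale_add_left scalar_sum)

lemma zero_in_unit_ball [simp]: "0 \<in> unit_ball X"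
  by (simp add: unit_ball_def)

text \<open>The inner product with a basis vector \<open>b\<close> isolates the coefficient of
  \<open>b\<close>, and \<open>b\<close> is nonzero; this gives uniqueness of coefficients.\<close>

lemma finite_basis_orthogonal:
  assumes "finite B" "B \<subseteq> space\<^sub>H X" "0 \<notin> B" "B \<subseteq> V"
    and orth: "\<And>b c. \<lbrakk>b \<in> B; c \<in> B; b \<noteq> c\<rbrakk> \<Longrightarrow> inner\<^sub>H X b c = 0"
    and span: "\<And>v. v \<in> V \<Longrightarrow> \<exists>a. (\<forall>b\<in>B. a b \<in> K) \<and> v = (\<Sum>b\<in>B. scale\<^sub>H X (a b) b)"
  shows "finite_basis K X V B"
  unfolding finite_basis_def
proof (intro conjI ballI)
  fix v assume "v \<in> V"
  then obtain a where a: "\<And>b. b \<in> B \<Longrightarrow> a b \<in> K" "v = (\<Sum>b\<in>B. scale\<^sub>H X (a b) b)"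
    using span by blast
  have coeff: "inner\<^sub>H X v b = c b * inner\<^sub>H X b b"
    if "b \<in> B" "c \<in> B \<rightarrow> K" "v = (\<Sum>b\<in>B. scale\<^sub>H X (c b) b)" for b c
    using inner_lincomb_orthogonal[of B c "\<lambda>b. b" b] assms(1,2) orth that by (auto simp: Pi_iff)
  have nz: "inner\<^sub>H X b b \<noteq> 0" if "b \<in> B" for b
    using inner_pos[of b] that assms(2,3) by fastforce
  show "\<exists>!c. c \<in> B \<rightarrow>\<^sub>E K \<and> v = (\<Sum>b\<in>B. scale\<^sub>H X (c b) b)"
  \<comment> \<open>\<open>finite_basis\<close> counts extensional coefficient functions, hence the
    restriction of \<open>a\<close> to \<open>B\<close>.\<close>
  proof (rule ex1I[of _ "restrict a B"])
    show "restrict a B \<in> B \<rightarrow>\<^sub>E K \<and> v = (\<Sum>b\<in>B. scale\<^sub>H X (restrict a B b) b)"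
      using a by auto
  next
    fix c assume c: "c \<in> B \<rightarrow>\<^sub>E K \<and> v = (\<Sum>b\<in>B. scale\<^sub>H X (c b) b)"
    show "c = restrict a B"
    proof (rule PiE_ext[of _ B "\<lambda>_. K"])
      fix b assume b: "b \<in> B"
      have "inner\<^sub>H X v b = c b * inner\<^sub>H X b b" using c b by (intro coeff) auto
      moreover have "inner\<^sub>H X v b = a b * inner\<^sub>H X b b" using a b by (intro coeff) auto
      ultimately show "c b = restrict a B b" using nz[OF b] b by simp
    qed (use c a in auto)
  qed
qed (use assms in auto)

text \<open>Gaussian elimination, by induction on the set \<open>J\<close> of equations, with the
  solution kept inside \<open>K\<close>. It serves to find a vector that an operator of small rank
  annihilates.\<close>

lemma homogeneous_system:
  assumes "finite J" "finite I" "card J < card I" "\<And>i j. \<lbrakk>i \<in> I; j \<in> J\<rbrakk> \<Longrightarrow> M i j \<in> K"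
  shows "\<exists>c. (\<forall>i\<in>I. c i \<in> K) \<and> (\<exists>i\<in>I. c i \<noteq> 0) \<and> (\<forall>j\<in>J. (\<Sum>i\<in>I. c i * M i j) = 0)"
  using assms
proof (induction J arbitrary: I M rule: finite_induct)
  case empty
  then have "I \<noteq> {}" by auto
  then show ?case by (intro exI[of _ "\<lambda>_. 1"]) auto
next
  case (insert j0 J)
  show ?case
  proof (cases "\<forall>i\<in>I. M i j0 = 0")
    case True
    have "\<exists>c. (\<forall>i\<in>I. c i \<in> K) \<and> (\<exists>i\<in>I. c i \<noteq> 0) \<and> (\<forall>j\<in>J. (\<Sum>i\<in>I. c i * M i j) = 0)"
      by (rule insert.IH) (use insert.prems insert.hyps in auto)
    then show ?thesis using True by auto
  next
    case False
    then obtain i0 where i0: "i0 \<in> I" "M i0 j0 \<noteq> 0" by auto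
    \<comment> \<open>Equation \<open>j0\<close>, with pivot \<open>M i0 j0\<close>, is solved for
      the unknown \<open>i0\<close> and substituted into the others. The column \<open>j0\<close> of
      \<open>M'\<close> vanishes.\<close>
    define M' where "M' i j = M i j - M i j0 / M i0 j0 * M i0 j" for i j
    have MK: "M i j \<in> K" if "i \<in> I" "j \<in> insert j0 J" for i j using insert.prems that by blast
    have M'K: "M' i j \<in> K" if "i \<in> I" "j \<in> J" for i j
      unfolding M'_def using that i0 MK by (intro scalar_ops) auto
    have "\<exists>c. (\<forall>i\<in>I-{i0}. c i \<in> K) \<and> (\<exists>i\<in>I-{i0}. c i \<noteq> 0) \<and>
        (\<forall>j\<in>J. (\<Sum>i\<in>I-{i0}. c i * M' i j) = 0)"
      by (rule insert.IH) (use insert.prems insert.hyps i0 M'K in auto)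
    then obtain c where c: "\<forall>i\<in>I-{i0}. c i \<in> K" "\<exists>i\<in>I-{i0}. c i \<noteq> 0"
      "\<And>j. j \<in> J \<Longrightarrow> (\<Sum>i\<in>I-{i0}. c i * M' i j) = 0" by blast
    \<comment> \<open>The value of the unknown \<open>i0\<close> forced by equation
      \<open>j0\<close>. With it every original equation takes its reduced form, and the reduced
      form of equation \<open>j0\<close> is trivial.\<close>
    define c0 where "c0 = - (\<Sum>i\<in>I-{i0}. c i * M i j0) / M i0 j0"
    define c' where "c' = c(i0 := c0)"
    have eq: "(\<Sum>i\<in>I. c' i * M i j) = (\<Sum>i\<in>I-{i0}. c i * M' i j)" for j
    proof -
      have "(\<Sum>i\<in>I. c' i * M i j) = c0 * M i0 j + (\<Sum>i\<in>I-{i0}. c' i * M i j)"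
        using i0 insert.prems by (subst sum.remove[of _ i0]) (auto simp: c'_def)
      also have "(\<Sum>i\<in>I-{i0}. c' i * M i j) = (\<Sum>i\<in>I-{i0}. c i * M i j)"
        by (intro sum.cong) (auto simp: c'_def)
      finally have 1: "(\<Sum>i\<in>I. c' i * M i j) = c0 * M i0 j + (\<Sum>i\<in>I-{i0}. c i * M i j)" .
      have "(\<Sum>i\<in>I-{i0}. c i * M' i j)
          = (\<Sum>i\<in>I-{i0}. c i * M i j - c i * M i j0 * (M i0 j / M i0 j0))"
        unfolding M'_def by (intro sum.cong refl) (simp add: algebra_simps)
      also have "\<dots> = (\<Sum>i\<in>I-{i0}. c i * M i j) - (\<Sum>i\<in>I-{i0}. c i * M i j0) * (M i0 j / M i0 j0)"
        by (simp add: sum_subtractf sum_distrib_right sum_divide_distrib)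
      finally show ?thesis using 1 by (simp add: c0_def)
    qed
    have "c0 \<in> K" unfolding c0_def using c(1) i0 MK by (intro scalar_ops scalar_sum) auto
    moreover have "M' i j0 = 0" for i using i0 by (simp add: M'_def)
    ultimately show ?thesis
      using c(1,2) c(3) eq by (intro exI[of _ c']) (auto simp: c'_def)
  qed
qed

end

section \<open>Bounded operators and their norms\<close>

locale bounded_operator = dom: hilbert_space K X + cod: hilbert_space K Y
  for K :: "complex set" and X :: "'a::ab_group_add hilbert" and Y :: "'b::ab_group_add hilbert" +
  fixes T :: "'a \<Rightarrow> 'b"
  assumes bounded: "bounded_op K X Y T"
begin

lemma closed [simp, intro]: "x \<in> space\<^sub>H X \<Longrightarrow> T x \<in> space\<^sub>H Y"
  using bounded by (auto simp: bounded_op_def)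

lemma map_add: "\<lbrakk>x \<in> space\<^sub>H X; y \<in> space\<^sub>H X\<rbrakk> \<Longrightarrow> T (x + y) = T x + T y"
  using bounded by (auto simp: bounded_op_def)

lemma map_scale: "\<lbrakk>a \<in> K; x \<in> space\<^sub>H X\<rbrakk> \<Longrightarrow> T (scale\<^sub>H X a x) = scale\<^sub>H Y a (T x)"
  using bounded by (auto simp: bounded_op_def)

lemma map_zero [simp]: "T 0 = 0"
  using map_add[of 0 0] by simp

lemma map_diff: "\<lbrakk>x \<in> space\<^sub>H X; y \<in> space\<^sub>H X\<rbrakk> \<Longrightarrow> T (x - y) = T x - T y"
  using map_add[of "x - y" y] by (simp add: algebra_simps)

lemma map_sum: "(\<And>i. i \<in> I \<Longrightarrow> f i \<in> space\<^sub>H X) \<Longrightarrow> T (\<Sum>i\<in>I. f i) = (\<Sum>i\<in>I. T (f i))"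
  by (induction I rule: infinite_finite_induct) (auto simp: map_add)

lemma map_lincomb:
  "\<lbrakk>\<And>i. i \<in> I \<Longrightarrow> c i \<in> K; \<And>i. i \<in> I \<Longrightarrow> f i \<in> space\<^sub>H X\<rbrakk> \<Longrightarrow>
    T (\<Sum>i\<in>I. scale\<^sub>H X (c i) (f i)) = (\<Sum>i\<in>I. scale\<^sub>H Y (c i) (T (f i)))"
  by (simp add: map_sum map_scale)

lemma map_proj:
  "\<lbrakk>orthonormal_or_zero X I e; x \<in> space\<^sub>H X\<rbrakk> \<Longrightarrow>
    T (proj\<^sub>H X I e x) = (\<Sum>i\<in>I. scale\<^sub>H Y (inner\<^sub>H X x (e i)) (T (e i)))"
  unfolding proj\<^sub>H_def by (intro map_lincomb) (auto simp: orthonormal_or_zero_def)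

lemma norm_bound:
  obtains C where "0 < C" "\<And>x. x \<in> space\<^sub>H X \<Longrightarrow> norm\<^sub>H Y (T x) \<le> C * norm\<^sub>H X x"
proof -
  obtain C where C: "\<And>x. x \<in> space\<^sub>H X \<Longrightarrow> norm\<^sub>H Y (T x) \<le> C * norm\<^sub>H X x"
    using bounded unfolding bounded_op_def by blast
  \<comment> \<open>The definition of boundedness allows any real constant; the maximum with 1 makes
    it positive.\<close>
  have "norm\<^sub>H Y (T x) \<le> max 1 C * norm\<^sub>H X x" if "x \<in> space\<^sub>H X" for x
    using C[OF that] mult_right_mono[of C "max 1 C" "norm\<^sub>H X x"] that by simp
  then show thesis using that[of "max 1 C"] by simp
qed

lemma bdd_above_unit_ball: "bdd_above ((\<lambda>x. norm\<^sub>H Y (T x)) ` unit_ball X)"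
proof -
  obtain C where C: "0 < C" "\<And>x. x \<in> space\<^sub>H X \<Longrightarrow> norm\<^sub>H Y (T x) \<le> C * norm\<^sub>H X x"
    using norm_bound by blast
  have "norm\<^sub>H Y (T x) \<le> C" if "x \<in> unit_ball X" for x
    using C(2)[of x] mult_left_le[OF _ less_imp_le[OF C(1)], of "norm\<^sub>H X x"] that
    by (simp add: unit_ball_def)
  then show ?thesis by (rule bdd_aboveI2)
qed

lemma norm_le_op_norm:
  assumes x: "x \<in> space\<^sub>H X" shows "norm\<^sub>H Y (T x) \<le> op_norm X Y T * norm\<^sub>H X x"
proof (cases "x = 0")
  case False
  let ?a = "complex_of_real (1 / norm\<^sub>H X x)"
  have n: "0 < norm\<^sub>H X x" using False x by (rule dom.norm_pos[rotated])
  have "norm\<^sub>H X (scale\<^sub>H X ?a x) = 1"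
    using n x by (subst dom.norm_scale) (auto simp: norm_divide simp del: of_real_divide)
  then have "scale\<^sub>H X ?a x \<in> unit_ball X" using x by (simp add: unit_ball_def del: of_real_divide)
  then have "norm\<^sub>H Y (T (scale\<^sub>H X ?a x)) \<le> op_norm X Y T"
    unfolding op_norm_def by (rule cSUP_upper[OF _ bdd_above_unit_ball])
  moreover have "norm\<^sub>H Y (T (scale\<^sub>H X ?a x)) = norm\<^sub>H Y (T x) / norm\<^sub>H X x"
    using n x by (simp add: map_scale cod.norm_scale norm_divide del: of_real_divide)
  ultimately have "norm\<^sub>H Y (T x) / norm\<^sub>H X x \<le> op_norm X Y T" by simp
  then show ?thesis using n by (simp add: divide_le_eq)
qed simp

lemma op_norm_nonneg: "0 \<le> op_norm X Y T"
  using cSUP_upper[OF dom.zero_in_unit_ball bdd_above_unit_ball] by (simp add: op_norm_def)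

lemma op_norm_le:
  assumes "0 \<le> \<delta>" "\<And>x. x \<in> space\<^sub>H X \<Longrightarrow> norm\<^sub>H Y (T x) \<le> \<delta> * norm\<^sub>H X x"
  shows "op_norm X Y T \<le> \<delta>"
  unfolding op_norm_def
proof (rule cSUP_least)
  show "unit_ball X \<noteq> {}" using dom.zero_in_unit_ball by blast
  fix x assume x: "x \<in> unit_ball X"
  then have "norm\<^sub>H Y (T x) \<le> \<delta> * norm\<^sub>H X x" using assms(2) by (simp add: unit_ball_def)
  also have "\<dots> \<le> \<delta> * 1" using x assms(1) by (intro mult_left_mono) (auto simp: unit_ball_def)
  finally show "norm\<^sub>H Y (T x) \<le> \<delta>" by simp
qed

lemma bounded_operator_diff:
  assumes "bounded_op K X Y A" shows "bounded_operator K X Y (\<lambda>x. T x - A x)"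
proof -
  interpret A: bounded_operator K X Y A using assms by unfold_locales
  obtain C where C: "\<And>x. x \<in> space\<^sub>H X \<Longrightarrow> norm\<^sub>H Y (T x) \<le> C * norm\<^sub>H X x"
    using norm_bound by blast
  obtain D where D: "\<And>x. x \<in> space\<^sub>H X \<Longrightarrow> norm\<^sub>H Y (A x) \<le> D * norm\<^sub>H X x"
    using A.norm_bound by blast
  have "norm\<^sub>H Y (T x - A x) \<le> (C + D) * norm\<^sub>H X x" if "x \<in> space\<^sub>H X" for x
    using C[OF that] D[OF that] cod.norm_triangle[of "T x" "- A x"] that
    by (simp add: cod.norm_minus algebra_simps)
  then have "bounded_op K X Y (\<lambda>x. T x - A x)"
    unfolding bounded_op_def
    by (intro conjI ballI exI[of _ "C + D"] funcsetI)
      (simp_all add: map_add A.map_add map_scale A.map_scale cod.scale_diff_right)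
  then show ?thesis by unfold_locales
qed

section \<open>Upper and lower bounds for approximation numbers\<close>

lemma bdd_below_approx_number:
  "bdd_below ((\<lambda>A. op_norm X Y (\<lambda>x. T x - A x)) ` {A. bounded_op K X Y A \<and> op_rank K X Y A < enat n})"
  by (rule bdd_belowI2[of _ 0]) (simp add: bounded_operator.op_norm_nonneg[OF bounded_operator_diff])

text \<open>The competitor in the infimum is \<open>T\<close> composed with the projection onto the
  \<open>e i\<close>. Its range is spanned by the orthogonal vectors \<open>T (e i)\<close>, so its
  rank is at most \<open>card I\<close>.\<close>

lemma approx_number_le:
  assumes e: "orthonormal_or_zero X I e" and I: "finite I" "card I < n"
    and orth: "\<And>i j. \<lbrakk>i \<in> I; j \<in> I; i \<noteq> j\<rbrakk> \<Longrightarrow> inner\<^sub>H Y (T (e i)) (T (e j)) = 0"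
    and \<delta>: "0 \<le> \<delta>" "\<And>x. x \<in> space\<^sub>H X \<Longrightarrow> norm\<^sub>H Y (T x - T (proj\<^sub>H X I e x)) \<le> \<delta> * norm\<^sub>H X x"
  shows "approx_number K X Y T n \<le> \<delta>"
proof -
  define A where "A x = T (proj\<^sub>H X I e x)" for x
  \<comment> \<open>A basis cannot contain 0, so vanishing images are dropped. On \<open>I'\<close>
    orthogonality makes the images distinct.\<close>
  define I' where "I' = {i \<in> I. T (e i) \<noteq> 0}"
  define B where "B = (\<lambda>i. T (e i)) ` I'"
  have eX: "e i \<in> space\<^sub>H X" if "i \<in> I" for i using e that by (simp add: orthonormal_or_zero_def)
  have P: "proj\<^sub>H X I e x \<in> space\<^sub>H X" if "x \<in> space\<^sub>H X" for x using dom.proj_closed[OF e that] .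
  obtain C where C: "0 < C" "\<And>x. x \<in> space\<^sub>H X \<Longrightarrow> norm\<^sub>H Y (T x) \<le> C * norm\<^sub>H X x"
    using norm_bound by blast
  have "norm\<^sub>H Y (A x) \<le> C * norm\<^sub>H X x" if "x \<in> space\<^sub>H X" for x
    unfolding A_def
    by (rule order_trans[OF C(2)[OF P[OF that]] mult_left_mono[OF dom.bessel(1)[OF e I(1) that]]])
      (use C(1) in simp)
  then have A: "bounded_op K X Y A"
    using P e unfolding bounded_op_def A_def
    by (intro conjI ballI exI[of _ C] funcsetI)
      (simp_all add: dom.proj_add dom.proj_scale map_add map_scale)
  have inj: "inj_on (\<lambda>i. T (e i)) I'"
  proof (rule inj_onI, rule ccontr)
    fix i j assume ij: "i \<in> I'" "j \<in> I'" "T (e i) = T (e j)" "i \<noteq> j"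
    then have "inner\<^sub>H Y (T (e i)) (T (e i)) = 0" using orth[of i j] by (simp add: I'_def)
    then show False using cod.inner_pos[of "T (e i)"] ij eX by (auto simp: I'_def)
  qed
  have "finite_basis K Y (A ` space\<^sub>H X) B"
  proof (rule cod.finite_basis_orthogonal)
    show "finite B" using I by (simp add: B_def I'_def)
    show "B \<subseteq> space\<^sub>H Y" "0 \<notin> B" using eX by (auto simp: B_def I'_def)
    show "inner\<^sub>H Y b c = 0" if "b \<in> B" "c \<in> B" "b \<noteq> c" for b c
      using that orth by (auto simp: B_def I'_def)
    show "B \<subseteq> A ` space\<^sub>H X"
    proof
      fix b assume "b \<in> B"
      then obtain i where i: "i \<in> I" "b = T (e i)" by (auto simp: B_def I'_def)
      \<comment> \<open>The projection fixes \<open>e i\<close>, so each \<open>T (e i)\<close> is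
        itself in the range of \<open>A\<close>.\<close>
      have "proj\<^sub>H X I e (e i) = (\<Sum>j\<in>I. if j = i then e i else 0)"
        unfolding proj\<^sub>H_def
      proof (intro sum.cong refl)
        fix j assume "j \<in> I"
        then show "scale\<^sub>H X (inner\<^sub>H X (e i) (e j)) (e j) = (if j = i then e i else 0)"
          using e i(1) eX[of i] unfolding orthonormal_or_zero_def
          by (cases "e i = 0") (auto simp: dom.inner_self dom.scale_one)
      qed
      then have "b = A (e i)" using i I by (simp add: A_def)
      then show "b \<in> A ` space\<^sub>H X" using eX i by blast
    qed
    fix v assume "v \<in> A ` space\<^sub>H X"
    then obtain x where x: "x \<in> space\<^sub>H X" "v = A x" by blast
    \<comment> \<open>Coefficients must be indexed by the basis vectors; they are pulled back along
      the injective map from \<open>I'\<close> to \<open>B\<close>.\<close>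
    define c where "c b = inner\<^sub>H X x (e (inv_into I' (\<lambda>i. T (e i)) b))" for b
    have cT: "c (T (e i)) = inner\<^sub>H X x (e i)" if "i \<in> I'" for i
      using inv_into_f_f[OF inj that] by (simp add: c_def)
    have "v = (\<Sum>i\<in>I. scale\<^sub>H Y (inner\<^sub>H X x (e i)) (T (e i)))"
      using x e by (simp add: A_def map_proj)
    also have "\<dots> = (\<Sum>i\<in>I'. scale\<^sub>H Y (inner\<^sub>H X x (e i)) (T (e i)))"
      using I x eX by (intro sum.mono_neutral_right) (auto simp: I'_def)
    also have "\<dots> = (\<Sum>b\<in>B. scale\<^sub>H Y (c b) b)"
      unfolding B_def by (subst sum.reindex[OF inj]) (simp add: cT)
    finally have "v = (\<Sum>b\<in>B. scale\<^sub>H Y (c b) b)" .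
    moreover have "\<forall>b\<in>B. c b \<in> K"
    proof
      fix b assume "b \<in> B"
      then have "inv_into I' (\<lambda>i. T (e i)) b \<in> I'" unfolding B_def by (rule inv_into_into)
      then show "c b \<in> K" using x eX by (auto simp: c_def I'_def)
    qed
    ultimately show "\<exists>a. (\<forall>b\<in>B. a b \<in> K) \<and> v = (\<Sum>b\<in>B. scale\<^sub>H Y (a b) b)" by blast
  qed
  then have "op_rank K X Y A \<le> enat (card B)"
    unfolding op_rank_def by (intro INF_lower) auto
  also have "card B \<le> card I"
    unfolding B_def I'_def using I by (intro card_image_le[THEN le_trans] card_mono) auto
  finally have "op_rank K X Y A < enat n" using I(2) by (meson enat_ord_simps le_less_trans)
  then have "approx_number K X Y T n \<le> op_norm X Y (\<lambda>x. T x - A x)"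
    unfolding approx_number_def using A by (intro cINF_lower bdd_below_approx_number) auto
  also have "\<dots> \<le> \<delta>"
    by (rule bounded_operator.op_norm_le[OF bounded_operator_diff[OF A]]) (use \<delta> in \<open>auto simp: A_def\<close>)
  finally show ?thesis .
qed

lemma zero_op: "bounded_op K X Y (\<lambda>x. 0)" "op_rank K X Y (\<lambda>x. 0) = 0"
proof -
  show "bounded_op K X Y (\<lambda>x. 0)" by (auto simp: bounded_op_def intro!: exI[of _ 0])
  have "finite_basis K Y ((\<lambda>x. 0) ` space\<^sub>H X) {}"
    by (rule cod.finite_basis_orthogonal) auto
  then have "op_rank K X Y (\<lambda>x. 0) \<le> enat (card ({} :: 'b set))"
    unfolding op_rank_def by (intro INF_lower) simp
  then show "op_rank K X Y (\<lambda>x. 0) = 0" by (simp add: zero_enat_def[symmetric])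
qed

text \<open>An operator \<open>A\<close> of rank below \<open>n\<close> annihilates a nonzero
  combination \<open>x\<close> of the \<open>e i\<close>. By Pythagoras in both spaces
  \<open>T\<close> stretches \<open>x\<close> by at least \<open>s\<close>, and so does
  \<open>T - A\<close>.\<close>

lemma approx_number_ge:
  assumes I: "finite I" "n \<le> card I" "1 \<le> n"
    and e: "\<And>i. i \<in> I \<Longrightarrow> e i \<in> space\<^sub>H X" "\<And>i. i \<in> I \<Longrightarrow> norm\<^sub>H X (e i) = 1"
    and orth: "\<And>i j. \<lbrakk>i \<in> I; j \<in> I; i \<noteq> j\<rbrakk> \<Longrightarrow> inner\<^sub>H X (e i) (e j) = 0"
      "\<And>i j. \<lbrakk>i \<in> I; j \<in> I; i \<noteq> j\<rbrakk> \<Longrightarrow> inner\<^sub>H Y (T (e i)) (T (e j)) = 0"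
    and s: "0 \<le> s" "\<And>i. i \<in> I \<Longrightarrow> s \<le> norm\<^sub>H Y (T (e i))"
  shows "s \<le> approx_number K X Y T n"
  unfolding approx_number_def
proof (rule cINF_greatest)
  \<comment> \<open>The zero operator has rank 0, so it competes as soon as \<open>n\<close> is at
    least 1.\<close>
  show "{A. bounded_op K X Y A \<and> op_rank K X Y A < enat n} \<noteq> {}"
    using zero_op I(3) by (auto simp: zero_enat_def intro!: exI[of _ "\<lambda>x. 0"])
  fix A assume "A \<in> {A. bounded_op K X Y A \<and> op_rank K X Y A < enat n}"
  then have A: "bounded_op K X Y A" and rank: "op_rank K X Y A < enat n" by auto
  interpret A: bounded_operator K X Y A using A by unfold_locales
  interpret D: bounded_operator K X Y "\<lambda>x. T x - A x" using A by (rule bounded_operator_diff)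
  obtain B where B: "finite_basis K Y (A ` space\<^sub>H X) B" "card B < n"
    using rank by (auto simp: op_rank_def INF_less_iff)
  have BY: "b \<in> space\<^sub>H Y" if "b \<in> B" for b using B that by (auto simp: finite_basis_def)
  have "\<exists>c. c \<in> B \<rightarrow>\<^sub>E K \<and> A (e i) = (\<Sum>b\<in>B. scale\<^sub>H Y (c b) b)" if "i \<in> I" for i
  proof -
    have "A (e i) \<in> A ` space\<^sub>H X" using e(1)[OF that] by (rule imageI)
    then have "\<exists>!c. c \<in> B \<rightarrow>\<^sub>E K \<and> A (e i) = (\<Sum>b\<in>B. scale\<^sub>H Y (c b) b)"
      using B(1) unfolding finite_basis_def by (elim conjE) (rule bspec)
    then show ?thesis by (rule ex1_implies_ex)
  qed
  then have "\<exists>M. \<forall>i\<in>I. M i \<in> B \<rightarrow>\<^sub>E K \<and> A (e i) = (\<Sum>b\<in>B. scale\<^sub>H Y (M i b) b)"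
    by (intro bchoice) simp
  then obtain M where "\<forall>i\<in>I. M i \<in> B \<rightarrow>\<^sub>E K \<and> A (e i) = (\<Sum>b\<in>B. scale\<^sub>H Y (M i b) b)" ..
  then have M: "\<And>i. i \<in> I \<Longrightarrow> M i \<in> B \<rightarrow>\<^sub>E K"
    "\<And>i. i \<in> I \<Longrightarrow> A (e i) = (\<Sum>b\<in>B. scale\<^sub>H Y (M i b) b)" by blast+
  have MK: "M i b \<in> K" if "i \<in> I" "b \<in> B" for i b using PiE_mem[OF M(1)[OF that(1)] that(2)] .
  have finB: "finite B" using B by (simp add: finite_basis_def)
  \<comment> \<open>\<open>M i\<close> holds the coordinates of \<open>A (e i)\<close> in the basis
    \<open>B\<close>. Since \<open>card B < n \<le> card I\<close>, there are fewer equations than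
    unknowns.\<close>
  obtain c where "(\<forall>i\<in>I. c i \<in> K) \<and> (\<exists>i\<in>I. c i \<noteq> 0) \<and> (\<forall>b\<in>B. (\<Sum>i\<in>I. c i * M i b) = 0)"
    using dom.homogeneous_system[OF finB I(1) less_le_trans[OF B(2) I(2)] MK] ..
  then have c: "\<And>i. i \<in> I \<Longrightarrow> c i \<in> K" "\<exists>i\<in>I. c i \<noteq> 0"
    "\<And>b. b \<in> B \<Longrightarrow> (\<Sum>i\<in>I. c i * M i b) = 0" by blast+
  define x where "x = (\<Sum>i\<in>I. scale\<^sub>H X (c i) (e i))"
  have x: "x \<in> space\<^sub>H X" unfolding x_def using c e by (intro dom.sum_closed dom.scale_closed)
  have "A x = (\<Sum>i\<in>I. scale\<^sub>H Y (c i) (\<Sum>b\<in>B. scale\<^sub>H Y (M i b) b))"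
    unfolding x_def using c e M(2) by (subst A.map_lincomb) auto
  also have "\<dots> = (\<Sum>i\<in>I. \<Sum>b\<in>B. scale\<^sub>H Y (c i * M i b) b)"
    using c(1) MK BY
    by (intro sum.cong refl) (simp add: cod.scale_sum_right cod.scale_scale)
  also have "\<dots> = (\<Sum>b\<in>B. scale\<^sub>H Y (\<Sum>i\<in>I. c i * M i b) b)"
    using c(1) MK BY by (subst sum.swap) (auto simp: cod.scale_sum_left intro!: sum.cong)
  also have "\<dots> = 0" using c(3) BY by (intro sum.neutral) simp
  finally have Ax: "A x = 0" .
  have nx: "(norm\<^sub>H X x)\<^sup>2 = (\<Sum>i\<in>I. (cmod (c i))\<^sup>2)"
    unfolding x_def using I c e orth by (subst dom.norm_lincomb_orthogonal) auto
  have "0 < (\<Sum>i\<in>I. (cmod (c i))\<^sup>2)"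
  proof -
    obtain i where "i \<in> I" "c i \<noteq> 0" using c(2) by blast
    then show ?thesis using I(1) by (intro sum_pos2[of I i]) auto
  qed
  then have "norm\<^sub>H X x \<noteq> 0" unfolding nx[symmetric] by auto
  then have pos: "0 < norm\<^sub>H X x" using dom.norm_nonneg[OF x] by linarith
  \<comment> \<open>Orthogonality of the \<open>e i\<close> evaluates the norm of \<open>x\<close>,
    and orthogonality of their images evaluates the norm of \<open>T x\<close>.\<close>
  have "(s * norm\<^sub>H X x)\<^sup>2 = (\<Sum>i\<in>I. (cmod (c i))\<^sup>2 * s\<^sup>2)"
    by (simp add: power_mult_distrib nx sum_distrib_left mult.commute)
  also have "\<dots> \<le> (\<Sum>i\<in>I. (cmod (c i))\<^sup>2 * (norm\<^sub>H Y (T (e i)))\<^sup>2)"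
    using s by (intro sum_mono mult_left_mono power_mono) auto
  also have "\<dots> = (norm\<^sub>H Y (T x))\<^sup>2"
    unfolding x_def using I c e orth
    by (subst map_lincomb) (auto simp: cod.norm_lincomb_orthogonal)
  finally have "s * norm\<^sub>H X x \<le> norm\<^sub>H Y (T x)"
    by (rule power2_le_imp_le) (use x in simp)
  also have "\<dots> \<le> op_norm X Y (\<lambda>x. T x - A x) * norm\<^sub>H X x"
    using D.norm_le_op_norm[OF x] Ax by simp
  finally show "s \<le> op_norm X Y (\<lambda>x. T x - A x)" using pos by simp
qed

lemma approx_number_nonneg: "1 \<le> n \<Longrightarrow> 0 \<le> approx_number K X Y T n"
  using zero_op unfolding approx_number_def
  by (intro cINF_greatest)
    (auto simp: zero_enat_def bounded_operator.op_norm_nonneg[OF bounded_operator_diff]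
      intro!: exI[of _ "\<lambda>x. 0"])

end

section \<open>Singular systems of compact operators\<close>

definition orthogonal_complement :: "'a::ab_group_add hilbert \<Rightarrow> 'a set \<Rightarrow> 'a set" where
  "orthogonal_complement X E = {x \<in> space\<^sub>H X. \<forall>e\<in>E. inner\<^sub>H X x e = 0}"

context hilbert_space
begin

lemma orthogonal_complement_closed:
  assumes "E \<subseteq> space\<^sub>H X"
  shows "0 \<in> orthogonal_complement X E"
    and "\<lbrakk>x \<in> orthogonal_complement X E; y \<in> orthogonal_complement X E\<rbrakk> \<Longrightarrow> x + y \<in> orthogonal_complement X E"
    and "\<lbrakk>a \<in> K; x \<in> orthogonal_complement X E\<rbrakk> \<Longrightarrow> scale\<^sub>H X a x \<in> orthogonal_complement X E"
  using assms
  by (auto simp: orthogonal_complement_def inner_zero inner_add_left inner_scale_left subset_iff)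

text \<open>Orthogonal complements are sequentially closed: up to sign, the inner product of the
  limit with \<open>e\<close> is that of \<open>f n - l\<close> with \<open>e\<close>, which tends
  to 0 by Cauchy-Schwarz.\<close>

lemma orthogonal_complement_limit:
  assumes E: "E \<subseteq> space\<^sub>H X" and f: "\<And>n. f n \<in> orthogonal_complement X E"
    and l: "l \<in> space\<^sub>H X" "(\<lambda>n. norm\<^sub>H X (f n - l)) \<longlonglongrightarrow> 0"
  shows "l \<in> orthogonal_complement X E"
proof -
  have "inner\<^sub>H X l e = 0" if e: "e \<in> E" for e
  proof -
    have eX: "e \<in> space\<^sub>H X" using E e by blast
    have "cmod (inner\<^sub>H X l e) \<le> norm\<^sub>H X (f n - l) * norm\<^sub>H X e" for n
    proof -
      have fX: "f n \<in> space\<^sub>H X" and "inner\<^sub>H X (f n) e = 0"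
        using f[of n] e by (auto simp: orthogonal_complement_def)
      then have "inner\<^sub>H X l e = - inner\<^sub>H X (f n - l) e"
        using l(1) eX by (simp add: inner_diff_left)
      then show ?thesis using norm_inner_le[of "f n - l" e] fX l(1) eX by simp
    qed
    moreover have "(\<lambda>n. norm\<^sub>H X (f n - l) * norm\<^sub>H X e) \<longlonglongrightarrow> 0"
      using tendsto_mult_left_zero[OF l(2)] .
    ultimately have "cmod (inner\<^sub>H X l e) \<le> 0"
      by (intro LIMSEQ_le_const) auto
    then show ?thesis by simp
  qed
  then show ?thesis using l(1) by (simp add: orthogonal_complement_def)
qed

end

section \<open>Maximising vectors of compact operators\<close>

locale compact_operator = bounded_operator +
  assumes compact: "compact_op K X Y T"
begin

text \<open>The image of the unit ball lies in a compact set and is therefore totally bounded;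
  sequences in totally bounded sets have Cauchy subsequences.\<close>

lemma Cauchy_subsequence:
  fixes x :: "nat \<Rightarrow> 'a"
  assumes "\<And>n. x n \<in> unit_ball X"
  shows "\<exists>r :: nat \<Rightarrow> nat. strict_mono r \<and>
    (\<forall>\<epsilon>>0. \<exists>N. \<forall>i\<ge>N. \<forall>j\<ge>N. norm\<^sub>H Y (T (x (r i)) - T (x (r j))) < \<epsilon>)"
proof -
  have sub: "T ` unit_ball X \<subseteq> space\<^sub>H Y" by (auto simp: unit_ball_def)
  have "cod.metric.mtotally_bounded (T ` unit_ball X)"
    using compact sub cod.metric.mtotally_bounded_eq_compact_closure_of
    unfolding compact_op_def
    by (metis cod.metric.compactin_imp_mtotally_bounded cod.metric.mtotally_bounded_subset
        closure_of_subset cod.metric.topspace_mtopology)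
  moreover have "range (\<lambda>n. T (x n)) \<subseteq> T ` unit_ball X" using assms by auto
  ultimately obtain r where r: "strict_mono r" "cod.metric.MCauchy ((\<lambda>n. T (x n)) \<circ> r)"
    unfolding cod.metric.mtotally_bounded_sequentially by blast
  have "((\<lambda>n. T (x n)) \<circ> r) i \<in> space\<^sub>H Y" for i using assms by (auto simp: unit_ball_def)
  from cod.MCauchy_iff_norm[of "(\<lambda>n. T (x n)) \<circ> r", OF this] r
  have "\<forall>\<epsilon>>0. \<exists>N. \<forall>i\<ge>N. \<forall>j\<ge>N. norm\<^sub>H Y (T (x (r i)) - T (x (r j))) < \<epsilon>"
    by (simp)
  with r(1) show ?thesis by blast
qed

text \<open>
  A maximising sequence whose images form a Cauchy sequence is itself a Cauchy sequence, by the
  parallelogram law in both spaces.  So no weak compactness is needed.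
\<close>

lemma attains_norm:
  assumes E: "E \<subseteq> space\<^sub>H X"
  defines "V \<equiv> orthogonal_complement X E"
  shows "\<exists>x\<in>V. (x = 0 \<or> norm\<^sub>H X x = 1) \<and> (T x = 0 \<longrightarrow> x = 0) \<and>
    (\<forall>z\<in>V. norm\<^sub>H Y (T z) \<le> norm\<^sub>H Y (T x) * norm\<^sub>H X z \<and>
      (inner\<^sub>H X z x = 0 \<longrightarrow> inner\<^sub>H Y (T z) (T x) = 0))"
proof -
  have V0: "0 \<in> V" and V_add: "\<And>x y. \<lbrakk>x \<in> V; y \<in> V\<rbrakk> \<Longrightarrow> x + y \<in> V"
    and V_scale: "\<And>a x. \<lbrakk>a \<in> K; x \<in> V\<rbrakk> \<Longrightarrow> scale\<^sub>H X a x \<in> V"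
    unfolding V_def using dom.orthogonal_complement_closed[OF E] by blast+
  have VX: "x \<in> space\<^sub>H X" if "x \<in> V" for x using that by (simp add: V_def orthogonal_complement_def)
  define W where "W = V \<inter> unit_ball X"
  have W0: "0 \<in> W" using V0 by (simp add: W_def)
  \<comment> \<open>\<open>m\<close> is the norm of the restriction of \<open>T\<close> to
    \<open>V\<close>, the value to be attained.\<close>
  define m where "m = (SUP x\<in>W. norm\<^sub>H Y (T x))"
  have bdd: "bdd_above ((\<lambda>x. norm\<^sub>H Y (T x)) ` W)"
    by (rule bdd_above_mono[OF bdd_above_unit_ball]) (auto simp: W_def)
  have upper: "norm\<^sub>H Y (T x) \<le> m" if "x \<in> W" for x
    unfolding m_def by (rule cSUP_upper[OF that bdd])
  have m0: "0 \<le> m" using upper[OF W0] by simp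
  have bound: "norm\<^sub>H Y (T z) \<le> m * norm\<^sub>H X z" if z: "z \<in> V" for z
  proof (cases "z = 0")
    case False
    define a where "a = complex_of_real (1 / norm\<^sub>H X z)"
    have aK: "a \<in> K" by (simp only: a_def dom.scalar_ops)
    have n: "0 < norm\<^sub>H X z" using dom.norm_pos[OF VX[OF z] False] .
    have ca: "cmod a = 1 / norm\<^sub>H X z" using n by (simp add: a_def norm_divide)
    have "scale\<^sub>H X a z \<in> W"
      using V_scale[OF aK z] n VX[OF z] aK by (simp add: W_def unit_ball_def dom.norm_scale ca)
    from upper[OF this] have "norm\<^sub>H Y (T z) / norm\<^sub>H X z \<le> m"
      using aK VX[OF z] by (simp add: map_scale cod.norm_scale ca)
    then show ?thesis using n by (simp add: divide_le_eq)
  qed simp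
  show ?thesis
  proof (cases "m = 0")
    \<comment> \<open>Here \<open>T\<close> vanishes on \<open>V\<close> and the zero vector
      satisfies all the conditions.\<close>
    case True
    then have "norm\<^sub>H Y (T z) = 0" if "z \<in> V" for z
      using bound[OF that] cod.norm_nonneg[OF closed[OF VX[OF that]]] by simp
    then show ?thesis using V0 VX by (intro bexI[of _ 0]) (auto simp: cod.inner_zero_right)
  next
    case False
    then have m: "0 < m" using m0 by simp
    have "\<exists>x\<in>W. m - 1 / real (Suc n) < norm\<^sub>H Y (T x)" for n
      using less_cSUP_iff[OF _ bdd, of "m - 1 / real (Suc n)"] W0 unfolding m_def[symmetric] by auto
    then obtain x where x: "\<And>n. x n \<in> W" "\<And>n. m - 1 / real (Suc n) < norm\<^sub>H Y (T (x n))" by metis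
    have "x n \<in> unit_ball X" for n using x(1)[of n] by (simp add: W_def)
    from Cauchy_subsequence[of x, OF this] obtain r :: "nat \<Rightarrow> nat" where r: "strict_mono r"
      "\<And>\<epsilon>. 0 < \<epsilon> \<Longrightarrow> \<exists>N. \<forall>i\<ge>N. \<forall>j\<ge>N. norm\<^sub>H Y (T (x (r i)) - T (x (r j))) < \<epsilon>"
      by blast
    define u where "u n = x (r n)" for n
    have u: "u n \<in> V" "norm\<^sub>H X (u n) \<le> 1" "u n \<in> space\<^sub>H X" for n
      using x(1)[of "r n"] VX by (auto simp: u_def W_def unit_ball_def)
    have Tu: "(\<lambda>n. norm\<^sub>H Y (T (u n))) \<longlonglongrightarrow> m"
    proof (rule tendsto_sandwich[of "\<lambda>n. m - 1 / real (Suc n)" _ _ "\<lambda>n. m"])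
      have "m - 1 / real (Suc n) \<le> norm\<^sub>H Y (T (u n))" for n
      proof -
        have "1 / real (Suc (r n)) \<le> 1 / real (Suc n)"
          using seq_suble[OF r(1), of n] by (intro divide_left_mono) auto
        then show ?thesis using x(2)[of "r n"] by (simp add: u_def)
      qed
      then show "\<forall>\<^sub>F n in sequentially. m - 1 / real (Suc n) \<le> norm\<^sub>H Y (T (u n))" by simp
      show "\<forall>\<^sub>F n in sequentially. norm\<^sub>H Y (T (u n)) \<le> m"
        using upper x(1) by (simp add: u_def)
      show "(\<lambda>n. m - 1 / real (Suc n)) \<longlonglongrightarrow> m"
        using tendsto_diff[OF tendsto_const LIMSEQ_inverse_real_of_nat]
        by (simp add: inverse_eq_divide)
    qed simp
    \<comment> \<open>The parallelogram law in \<open>Y\<close> expresses the sum of the images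
      through their difference, \<open>m\<close> bounds the norm of the image sum, and the
      parallelogram law in \<open>X\<close> trades the sum \<open>u i + u j\<close> for the
      difference \<open>u i - u j\<close>.\<close>
    have key: "m\<^sup>2 * (norm\<^sub>H X (u i - u j))\<^sup>2
        \<le> 4 * m\<^sup>2 - 2 * (norm\<^sub>H Y (T (u i)))\<^sup>2 - 2 * (norm\<^sub>H Y (T (u j)))\<^sup>2 + (norm\<^sub>H Y (T (u i) - T (u j)))\<^sup>2"
      for i j
    proof -
      have "(norm\<^sub>H Y (T (u i + u j)))\<^sup>2 \<le> (m * norm\<^sub>H X (u i + u j))\<^sup>2"
        using bound[OF V_add[OF u(1) u(1)]] u by (intro power_mono) auto
      then have 1: "(norm\<^sub>H Y (T (u i) + T (u j)))\<^sup>2 \<le> m\<^sup>2 * (norm\<^sub>H X (u i + u j))\<^sup>2"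
        using u by (simp add: map_add power_mult_distrib)
      have "(norm\<^sub>H X (u i + u j))\<^sup>2 + (norm\<^sub>H X (u i - u j))\<^sup>2 \<le> 4"
        using dom.parallelogram[of "u i" "u j"] u power_mono[OF u(2)[of i], of 2]
          power_mono[OF u(2)[of j], of 2] by simp
      then have "m\<^sup>2 * ((norm\<^sub>H X (u i + u j))\<^sup>2 + (norm\<^sub>H X (u i - u j))\<^sup>2) \<le> m\<^sup>2 * 4"
        by (rule mult_left_mono) simp
      then show ?thesis
        using 1 cod.parallelogram[of "T (u i)" "T (u j)"] u by (simp add: distrib_left)
    qed
    have "\<exists>N. \<forall>i\<ge>N. \<forall>j\<ge>N. norm\<^sub>H X (u i - u j) < \<epsilon>" if \<epsilon>: "0 < \<epsilon>" for \<epsilon>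
    proof -
      \<comment> \<open>With squared image norms above \<open>m\<^sup>2 - \<delta>\<close> and
        squared image distance below \<open>\<delta>\<close>, the right side of \<open>key\<close>
        is below \<open>5 * \<delta>\<close>, which is
        \<open>m\<^sup>2 * \<epsilon>\<^sup>2\<close>.\<close>
      define \<delta> where "\<delta> = m\<^sup>2 * \<epsilon>\<^sup>2 / 5"
      have \<delta>: "0 < \<delta>" using m \<epsilon> by (simp add: \<delta>_def)
      have "(\<lambda>n. (norm\<^sub>H Y (T (u n)))\<^sup>2) \<longlonglongrightarrow> m\<^sup>2" using Tu by (rule tendsto_power)
      then have "\<forall>\<^sub>F n in sequentially. m\<^sup>2 - \<delta> < (norm\<^sub>H Y (T (u n)))\<^sup>2"
        by (rule order_tendstoD) (use \<delta> in simp)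
      then obtain N1 where N1: "\<And>n. n \<ge> N1 \<Longrightarrow> m\<^sup>2 - \<delta> < (norm\<^sub>H Y (T (u n)))\<^sup>2"
        by (auto simp: eventually_sequentially)
      obtain N2 where N2: "\<And>i j. \<lbrakk>i \<ge> N2; j \<ge> N2\<rbrakk> \<Longrightarrow> norm\<^sub>H Y (T (u i) - T (u j)) < sqrt \<delta>"
        using r(2)[of "sqrt \<delta>"] \<delta> by (auto simp: u_def)
      have "norm\<^sub>H X (u i - u j) < \<epsilon>" if ij: "i \<ge> max N1 N2" "j \<ge> max N1 N2" for i j
      proof -
        have "(norm\<^sub>H Y (T (u i) - T (u j)))\<^sup>2 < (sqrt \<delta>)\<^sup>2"
          using N2[of i j] ij u by (intro power_strict_mono) auto
        then have "(norm\<^sub>H Y (T (u i) - T (u j)))\<^sup>2 < \<delta>" using \<delta> by simp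
        then have "m\<^sup>2 * (norm\<^sub>H X (u i - u j))\<^sup>2 < 5 * \<delta>"
          using key[of i j] N1[of i] N1[of j] ij by simp
        then have "(norm\<^sub>H X (u i - u j))\<^sup>2 < \<epsilon>\<^sup>2" using m by (simp add: \<delta>_def)
        then show ?thesis using \<epsilon> by (simp add: power_less_imp_less_base)
      qed
      then show ?thesis by blast
    qed
    then obtain l where l: "l \<in> space\<^sub>H X" "(\<lambda>n. norm\<^sub>H X (u n - l)) \<longlonglongrightarrow> 0"
      using dom.Cauchy_limit[of u] u(3) by metis
    have lV: "l \<in> V"
      using dom.orthogonal_complement_limit[OF E _ l] u(1) by (simp add: V_def)
    have "norm\<^sub>H X l \<le> 1 + norm\<^sub>H X (u n - l)" for n
      using dom.norm_diff_triangle[OF l(1) u(3), of n] dom.norm_diff_commute[OF l(1) u(3), of n] u(2)[of n]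
      by simp
    moreover have "(\<lambda>n. 1 + norm\<^sub>H X (u n - l)) \<longlonglongrightarrow> 1 + 0"
      by (intro tendsto_add tendsto_const l)
    ultimately have l1: "norm\<^sub>H X l \<le> 1" by (intro LIMSEQ_le_const) auto
    obtain C where C: "0 < C" "\<And>x. x \<in> space\<^sub>H X \<Longrightarrow> norm\<^sub>H Y (T x) \<le> C * norm\<^sub>H X x"
      using norm_bound by blast
    have "norm\<^sub>H Y (T (u n)) \<le> norm\<^sub>H Y (T l) + C * norm\<^sub>H X (u n - l)" for n
      using cod.norm_diff_triangle[of "T (u n)" "T l"] C(2)[of "u n - l"] u(3)[of n] l(1)
      by (simp add: map_diff)
    moreover have "(\<lambda>n. norm\<^sub>H Y (T l) + C * norm\<^sub>H X (u n - l)) \<longlonglongrightarrow> norm\<^sub>H Y (T l) + C * 0"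
      by (intro tendsto_intros l)
    ultimately have "m \<le> norm\<^sub>H Y (T l)" using LIMSEQ_le[OF Tu] by auto
    moreover have "norm\<^sub>H Y (T l) \<le> m" using l1 lV l(1) by (intro upper) (auto simp: W_def unit_ball_def)
    ultimately have Tl: "norm\<^sub>H Y (T l) = m" by simp
    then have nl: "norm\<^sub>H X l = 1" using bound[OF lV] m l1 by simp
    \<comment> \<open>First-order condition at the maximum: if the images were not orthogonal,
      moving \<open>l\<close> slightly in a suitable multiple of the direction \<open>z\<close>
      would change the norm of \<open>l\<close> only to second order but raise that of
      \<open>T l\<close> to first order.\<close>
    have "inner\<^sub>H Y (T z) (T l) = 0" if z: "z \<in> V" "inner\<^sub>H X z l = 0" for z
    proof (rule ccontr)
      define w where "w = inner\<^sub>H Y (T z) (T l)"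
      assume "inner\<^sub>H Y (T z) (T l) \<noteq> 0"
      then have b: "0 < (cmod w)\<^sup>2" by (simp add: w_def)
      note zX = VX[OF z(1)]
      have wK: "cnj w \<in> K" using zX l by (simp add: w_def)
      \<comment> \<open>Multiplying \<open>z\<close> by the conjugate of \<open>w\<close> makes the
        inner product of \<open>T l\<close> and \<open>T y\<close> real and positive, so a real
        parameter \<open>t\<close> suffices for complex scalars too.\<close>
      define y where "y = scale\<^sub>H X (cnj w) z"
      have y: "y \<in> V" "y \<in> space\<^sub>H X" using V_scale[OF wK z(1)] VX by (auto simp: y_def)
      have ly: "inner\<^sub>H X l y = 0"
        using z(2) dom.inner_commute[OF l(1) zX] zX l(1) wK by (simp add: y_def dom.inner_scale_right)
      have "inner\<^sub>H Y (T l) (T y) = w * cnj w"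
        using zX l(1) wK cod.inner_commute[of "T l" "T z"]
        by (simp add: y_def map_scale cod.inner_scale_right w_def)
      then have Tly: "Re (inner\<^sub>H Y (T l) (T y)) = (cmod w)\<^sup>2"
        by (simp flip: complex_norm_square)
      define c where "c = m\<^sup>2 * (norm\<^sub>H X y)\<^sup>2"
      have c: "0 \<le> c" by (simp add: c_def)
      have quad: "2 * t * (cmod w)\<^sup>2 \<le> t\<^sup>2 * c" for t
      proof -
        let ?v = "l + scale\<^sub>H X (of_real t) y"
        have v: "?v \<in> V" by (intro V_add V_scale lV y dom.scalar_ops)
        have "(norm\<^sub>H Y (T ?v))\<^sup>2 \<le> (m * norm\<^sub>H X ?v)\<^sup>2"
          using bound[OF v] VX[OF v] by (intro power_mono) auto
        moreover have "(norm\<^sub>H X ?v)\<^sup>2 = 1 + t\<^sup>2 * (norm\<^sub>H X y)\<^sup>2"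
          using dom.Re_inner_expand[OF l(1) y(2), of t] dom.norm_square[OF VX[OF v]] ly nl
            dom.norm_square[OF l(1)] dom.norm_square[OF y(2)] by simp
        moreover have "T ?v = T l + scale\<^sub>H Y (of_real t) (T y)"
          using l y by (simp add: map_add map_scale)
        then have "(norm\<^sub>H Y (T ?v))\<^sup>2 = m\<^sup>2 + 2 * t * (cmod w)\<^sup>2 + t\<^sup>2 * (norm\<^sub>H Y (T y))\<^sup>2"
          using cod.Re_inner_expand[OF closed[OF l(1)] closed[OF y(2)], of t]
            cod.norm_square[OF closed[OF VX[OF v]]] Tly Tl
            cod.norm_square[OF closed[OF l(1)]] cod.norm_square[OF closed[OF y(2)]] by simp
        ultimately have "2 * t * (cmod w)\<^sup>2 + t\<^sup>2 * (norm\<^sub>H Y (T y))\<^sup>2 \<le> t\<^sup>2 * c"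
          by (simp add: power_mult_distrib c_def algebra_simps)
        moreover have "0 \<le> t\<^sup>2 * (norm\<^sub>H Y (T y))\<^sup>2" by simp
        ultimately show ?thesis by linarith
      qed
      \<comment> \<open>Then \<open>t * c\<close> is less than \<open>(cmod w)\<^sup>2\<close>,
        while \<open>quad\<close> makes it at least twice that. Adding 1 to \<open>c\<close> avoids
        division by zero.\<close>
      define t where "t = (cmod w)\<^sup>2 / (c + 1)"
      have t: "0 < t" "t * (c + 1) = (cmod w)\<^sup>2" using b c by (auto simp: t_def)
      have "t * (2 * (cmod w)\<^sup>2) \<le> t * (t * c)"
        using quad[of t] by (simp add: power2_eq_square algebra_simps)
      then have "2 * (cmod w)\<^sup>2 \<le> t * c" using t(1) by simp
      then show False using t b by (simp add: algebra_simps)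
    qed
    then show ?thesis
      using lV nl Tl bound m by (intro bexI[of _ l]) auto
  qed
qed

end

text \<open>Each \<open>e n\<close> maximises the norm of the image among unit vectors orthogonal to
  its predecessors, and \<open>e_image_orth\<close> is the first-order condition at this maximum. By
  \<open>e_zero\<close> the system continues with zero vectors once the range of \<open>T\<close> is
  exhausted.\<close>

locale singular_system = bounded_operator +
  fixes e :: "nat \<Rightarrow> 'a"
  assumes e_closed [simp, intro]: "e n \<in> space\<^sub>H X"
    and e_norm: "e n = 0 \<or> norm\<^sub>H X (e n) = 1"
    and e_zero: "T (e n) = 0 \<Longrightarrow> e n = 0"
    and e_orth: "k < n \<Longrightarrow> inner\<^sub>H X (e n) (e k) = 0"
    and e_max: "\<lbrakk>z \<in> space\<^sub>H X; \<And>k. k < n \<Longrightarrow> inner\<^sub>H X z (e k) = 0\<rbrakk> \<Longrightarrow>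
      norm\<^sub>H Y (T z) \<le> norm\<^sub>H Y (T (e n)) * norm\<^sub>H X z"
    and e_image_orth: "\<lbrakk>z \<in> space\<^sub>H X; \<And>k. k \<le> n \<Longrightarrow> inner\<^sub>H X z (e k) = 0\<rbrakk> \<Longrightarrow>
      inner\<^sub>H Y (T z) (T (e n)) = 0"

text \<open>The vectors are chosen by well-founded recursion, each by \<open>attains_norm\<close> in
  the complement of the earlier ones. The requirement \<open>P e n\<close> depends only on the
  values of \<open>e\<close> below \<open>n\<close>.\<close>

lemma (in compact_operator) singular_system_exists:
  "\<exists>e. singular_system K X Y T e"
proof -
  define P where "P e n x \<longleftrightarrow> x \<in> orthogonal_complement X (e ` {..<n}) \<and>
    (x = 0 \<or> norm\<^sub>H X x = 1) \<and> (T x = 0 \<longrightarrow> x = 0) \<and>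
    (\<forall>z\<in>orthogonal_complement X (e ` {..<n}). norm\<^sub>H Y (T z) \<le> norm\<^sub>H Y (T x) * norm\<^sub>H X z \<and>
      (inner\<^sub>H X z x = 0 \<longrightarrow> inner\<^sub>H Y (T z) (T x) = 0))" for e :: "nat \<Rightarrow> 'a" and n x
  have "\<exists>e. \<forall>n. P e n (e n)"
  proof (rule dependent_wf_choice[OF wf])
    fix f g :: "nat \<Rightarrow> 'a" and n r assume "\<And>k. (k, n) \<in> {(x, y). x < y} \<Longrightarrow> f k = g k"
    then have "f ` {..<n} = g ` {..<n}" by (intro image_cong) auto
    then show "P f n r = P g n r" by (simp add: P_def)
  next
    fix n and f :: "nat \<Rightarrow> 'a" assume "\<And>k. (k, n) \<in> {(x, y). x < y} \<Longrightarrow> P f k (f k)"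
    then have "f ` {..<n} \<subseteq> space\<^sub>H X" by (auto simp: P_def orthogonal_complement_def)
    then show "\<exists>x. P f n x" using attains_norm unfolding P_def by blast
  qed
  then obtain e where e: "\<And>n. P e n (e n)" by blast
  have "singular_system K X Y T e"
  proof unfold_locales
    show "e n \<in> space\<^sub>H X" "e n = 0 \<or> norm\<^sub>H X (e n) = 1" for n
      using e[of n] by (auto simp: P_def orthogonal_complement_def)
    show "e n = 0" if "T (e n) = 0" for n using e[of n] that by (simp add: P_def)
    show "inner\<^sub>H X (e n) (e k) = 0" if "k < n" for n k
      using e[of n] that by (auto simp: P_def orthogonal_complement_def)
    fix z n assume z: "z \<in> space\<^sub>H X"
    show "norm\<^sub>H Y (T z) \<le> norm\<^sub>H Y (T (e n)) * norm\<^sub>H X z"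
      if "\<And>k. k < n \<Longrightarrow> inner\<^sub>H X z (e k) = 0"
      using e[of n] z that by (auto simp: P_def orthogonal_complement_def)
    show "inner\<^sub>H Y (T z) (T (e n)) = 0" if "\<And>k. k \<le> n \<Longrightarrow> inner\<^sub>H X z (e k) = 0"
      using e[of n] z that by (auto simp: P_def orthogonal_complement_def)
  qed
  then show ?thesis by blast
qed

section \<open>Singular values and Parseval's identity\<close>

context singular_system
begin

text \<open>Singular values are counted from 0, approximation numbers from 1, so
  \<open>sval n\<close> is the approximation number with index \<open>Suc n\<close>.\<close>

definition sval :: "nat \<Rightarrow> real" where "sval n = norm\<^sub>H Y (T (e n))"

lemma sval_nonneg [simp]: "0 \<le> sval n" by (simp add: sval_def)

lemma inner_e_neq: "i \<noteq> j \<Longrightarrow> inner\<^sub>H X (e i) (e j) = 0"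
  using e_orth[of i j] e_orth[of j i] dom.inner_commute[of "e i" "e j"] by (cases i j rule: linorder_cases) auto

lemma orthonormal_e: "orthonormal_or_zero X I e"
  using e_norm inner_e_neq by (auto simp: orthonormal_or_zero_def)

lemma inner_image_neq: "i \<noteq> j \<Longrightarrow> inner\<^sub>H Y (T (e i)) (T (e j)) = 0"
proof (induction i j rule: linorder_wlog)
  case (le i j)
  then have "inner\<^sub>H Y (T (e j)) (T (e i)) = 0"
    by (intro e_image_orth) (auto intro!: inner_e_neq)
  then show ?case using cod.inner_commute[of "T (e i)" "T (e j)"] by simp
next
  case (sym i j)
  then show ?case using cod.inner_commute[of "T (e i)" "T (e j)"] by simp
qed

lemma norm_e: "sval n \<noteq> 0 \<Longrightarrow> norm\<^sub>H X (e n) = 1"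
  using e_norm[of n] by (auto simp: sval_def)

lemma sval_antimono: "m \<le> n \<Longrightarrow> sval n \<le> sval m"
proof -
  assume "m \<le> n"
  then have "sval n \<le> sval m * norm\<^sub>H X (e n)"
    unfolding sval_def by (intro e_max) (auto intro!: inner_e_neq)
  also have "\<dots> \<le> sval m" using e_norm[of n] by auto
  finally show ?thesis .
qed

text \<open>The residual is orthogonal to \<open>e 0\<close> up to \<open>e (n - 1)\<close>, so the
  maximality of \<open>e n\<close> bounds its image; projecting does not increase the norm.\<close>

lemma residual_bound:
  assumes "x \<in> space\<^sub>H X"
  shows "norm\<^sub>H Y (T x - T (proj\<^sub>H X {..<n} e x)) \<le> sval n * norm\<^sub>H X x"
proof -
  let ?p = "proj\<^sub>H X {..<n} e x"
  have p: "?p \<in> space\<^sub>H X" using dom.proj_closed[OF orthonormal_e assms] .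
  have "norm\<^sub>H Y (T (x - ?p)) \<le> sval n * norm\<^sub>H X (x - ?p)"
    unfolding sval_def using p assms
    by (intro e_max) (auto intro!: dom.inner_residual[OF orthonormal_e])
  also have "\<dots> \<le> sval n * norm\<^sub>H X x"
    using dom.bessel(2)[OF orthonormal_e _ assms, of "{..<n}"] by (intro mult_left_mono) auto
  finally show ?thesis using p assms by (simp add: map_diff)
qed

lemma residual_orth:
  assumes "x \<in> space\<^sub>H X" "k < n"
  shows "inner\<^sub>H Y (T (x - proj\<^sub>H X {..<n} e x)) (T (e k)) = 0"
  using assms dom.proj_closed[OF orthonormal_e assms(1)]
  by (intro e_image_orth) (auto intro!: dom.inner_residual[OF orthonormal_e])

text \<open>The weak form of the statement that \<open>e k\<close> is an eigenvector of the adjoint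
  of \<open>T\<close> times \<open>T\<close>, with eigenvalue the square of \<open>sval k\<close>.
  Replacing \<open>x\<close> by its projection onto \<open>e 0\<close> up to \<open>e k\<close>
  leaves the left side unchanged, and only the term of index \<open>k\<close> survives.\<close>

lemma inner_image:
  assumes x: "x \<in> space\<^sub>H X"
  shows "inner\<^sub>H Y (T x) (T (e k)) = inner\<^sub>H X x (e k) * of_real ((sval k)\<^sup>2)"
proof -
  let ?p = "proj\<^sub>H X {..<Suc k} e x"
  have p: "?p \<in> space\<^sub>H X" using dom.proj_closed[OF orthonormal_e x] .
  have "inner\<^sub>H Y (T x) (T (e k)) = inner\<^sub>H Y (T ?p) (T (e k))"
    using residual_orth[OF x, of k "Suc k"] p x by (simp add: map_diff cod.inner_diff_left)
  also have "\<dots> = inner\<^sub>H X x (e k) * inner\<^sub>H Y (T (e k)) (T (e k))"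
    unfolding map_proj[OF orthonormal_e x] using x
    by (intro cod.inner_lincomb_orthogonal) (auto intro: inner_image_neq)
  finally show ?thesis by (simp add: cod.inner_self sval_def)
qed

text \<open>The defect of the partial sum is the squared norm of the image of the residual, at most
  the square of \<open>sval n * norm\<^sub>H X x\<close>.\<close>

lemma parseval:
  assumes x: "x \<in> space\<^sub>H X" and s: "sval \<longlonglongrightarrow> 0"
  shows "(\<lambda>n. \<Sum>k<n. (cmod (inner\<^sub>H X x (e k)))\<^sup>2 * (sval k)\<^sup>2) \<longlonglongrightarrow> (norm\<^sub>H Y (T x))\<^sup>2"
proof -
  define p where "p n = proj\<^sub>H X {..<n} e x" for n
  have p: "p n \<in> space\<^sub>H X" for n unfolding p_def using dom.proj_closed[OF orthonormal_e x] .
  have eq: "(\<Sum>k<n. (cmod (inner\<^sub>H X x (e k)))\<^sup>2 * (sval k)\<^sup>2)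
      = (norm\<^sub>H Y (T x))\<^sup>2 - (norm\<^sub>H Y (T x - T (p n)))\<^sup>2" for n
  proof -
    have Tp: "T (p n) = (\<Sum>i<n. scale\<^sub>H Y (inner\<^sub>H X x (e i)) (T (e i)))"
      unfolding p_def using map_proj[OF orthonormal_e x] .
    have "inner\<^sub>H Y (T (x - p n)) (T (p n))
        = (\<Sum>i<n. cnj (inner\<^sub>H X x (e i)) * inner\<^sub>H Y (T (x - p n)) (T (e i)))"
      unfolding Tp using x p by (subst cod.inner_sum_right) (auto simp: cod.inner_scale_right)
    also have "\<dots> = 0"
      using residual_orth[OF x] by (intro sum.neutral) (simp add: p_def)
    finally have "(norm\<^sub>H Y (T (x - p n) + T (p n)))\<^sup>2 = (norm\<^sub>H Y (T (x - p n)))\<^sup>2 + (norm\<^sub>H Y (T (p n)))\<^sup>2"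
      using x p by (intro cod.pythagoras) auto
    moreover have "(norm\<^sub>H Y (T (p n)))\<^sup>2 = (\<Sum>k<n. (cmod (inner\<^sub>H X x (e k)))\<^sup>2 * (sval k)\<^sup>2)"
      unfolding Tp sval_def using x
      by (intro cod.norm_lincomb_orthogonal) (auto intro: inner_image_neq)
    ultimately show ?thesis using x p by (simp add: map_diff)
  qed
  have "(\<lambda>n. norm\<^sub>H Y (T x - T (p n))) \<longlonglongrightarrow> 0"
  proof (rule tendsto_sandwich[of "\<lambda>_. 0" _ _ "\<lambda>n. sval n * norm\<^sub>H X x"])
    show "(\<lambda>n. sval n * norm\<^sub>H X x) \<longlonglongrightarrow> 0" using tendsto_mult_left_zero[OF s] .
  qed (use x p residual_bound[OF x] in \<open>auto simp: p_def\<close>)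
  then have "(\<lambda>n. (norm\<^sub>H Y (T x))\<^sup>2 - (norm\<^sub>H Y (T x - T (p n)))\<^sup>2) \<longlonglongrightarrow> (norm\<^sub>H Y (T x))\<^sup>2 - 0\<^sup>2"
    by (intro tendsto_intros)
  then show ?thesis by (simp add: eq)
qed

text \<open>Truncation after \<open>n\<close> terms gives the upper bound, and the
  \<open>n + 1\<close> vectors \<open>e 0\<close> to \<open>e n\<close> give the lower bound. They
  are unit vectors only if \<open>sval n\<close> is nonzero, whence the case distinction.\<close>

lemma approx_number_Suc: "approx_number K X Y T (Suc n) = sval n"
proof (rule antisym)
  show "approx_number K X Y T (Suc n) \<le> sval n"
    by (rule approx_number_le[OF orthonormal_e[of "{..<n}"]])
      (auto simp: residual_bound inner_image_neq)
  show "sval n \<le> approx_number K X Y T (Suc n)"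
  proof (cases "sval n = 0")
    case True
    then show ?thesis by (simp add: approx_number_nonneg)
  next
    case False
    have "norm\<^sub>H X (e k) = 1" if "k \<le> n" for k
      using sval_antimono[OF that] False sval_nonneg[of n] by (intro norm_e) linarith
    then show ?thesis
      using sval_antimono
      by (intro approx_number_ge[of "{..n}" _ e]) (auto simp: inner_e_neq inner_image_neq sval_def)
  qed
qed

text \<open>For index 0 the orthogonality condition in \<open>e_max\<close> is empty, so
  \<open>e 0\<close> maximises over the whole space.\<close>

lemma sval_0: "sval 0 = op_norm X Y T"
proof (rule antisym)
  have "sval 0 \<le> op_norm X Y T * norm\<^sub>H X (e 0)"
    using norm_le_op_norm[of "e 0"] by (simp add: sval_def)
  also have "\<dots> \<le> op_norm X Y T" using e_norm[of 0] op_norm_nonneg by auto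
  finally show "sval 0 \<le> op_norm X Y T" .
  show "op_norm X Y T \<le> sval 0"
    by (rule op_norm_le) (auto simp: sval_def intro!: e_max)
qed

end

section \<open>Tensor powers\<close>

text \<open>The \<open>c i\<close> are the Fourier coefficients of \<open>g\<close>. Their defining
  equation is multiplied out so that it also covers vanishing \<open>f i\<close>.\<close>

lemma (in hilbert_space) norm_residual_orthogonal:
  assumes I: "finite I" "\<And>i. i \<in> I \<Longrightarrow> c i \<in> K" "\<And>i. i \<in> I \<Longrightarrow> f i \<in> space\<^sub>H X"
    and orth: "\<And>i j. \<lbrakk>i \<in> I; j \<in> I; i \<noteq> j\<rbrakk> \<Longrightarrow> inner\<^sub>H X (f i) (f j) = 0"
    and g: "g \<in> space\<^sub>H X" "\<And>i. i \<in> I \<Longrightarrow> inner\<^sub>H X g (f i) = c i * inner\<^sub>H X (f i) (f i)"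
  shows "(norm\<^sub>H X (g - (\<Sum>i\<in>I. scale\<^sub>H X (c i) (f i))))\<^sup>2
    = (norm\<^sub>H X g)\<^sup>2 - (\<Sum>i\<in>I. (cmod (c i))\<^sup>2 * (norm\<^sub>H X (f i))\<^sup>2)"
proof -
  define p where "p = (\<Sum>i\<in>I. scale\<^sub>H X (c i) (f i))"
  have p: "p \<in> space\<^sub>H X" unfolding p_def using I by (intro sum_closed scale_closed)
  have "inner\<^sub>H X (g - p) (f i) = 0" if "i \<in> I" for i
  proof -
    have "inner\<^sub>H X p (f i) = c i * inner\<^sub>H X (f i) (f i)"
      unfolding p_def using I orth that by (intro inner_lincomb_orthogonal)
    then show ?thesis using g I(3)[OF that] that p by (simp add: inner_diff_left)
  qed
  moreover have "inner\<^sub>H X y p = (\<Sum>i\<in>I. cnj (c i) * inner\<^sub>H X y (f i))" if "y \<in> space\<^sub>H X" for y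
    unfolding p_def using I that by (subst inner_sum_right) (auto simp: inner_scale_right)
  ultimately have "inner\<^sub>H X (g - p) p = 0" using g p by simp
  from pythagoras[OF _ _ this] have "(norm\<^sub>H X g)\<^sup>2 = (norm\<^sub>H X (g - p))\<^sup>2 + (norm\<^sub>H X p)\<^sup>2"
    using g p by simp
  moreover have "(norm\<^sub>H X p)\<^sup>2 = (\<Sum>i\<in>I. (cmod (c i))\<^sup>2 * (norm\<^sub>H X (f i))\<^sup>2)"
    unfolding p_def using I orth by (intro norm_lincomb_orthogonal)
  ultimately show ?thesis by (simp add: p_def)
qed

locale tensor_singular_system = base: singular_system K X Y T e + big: bounded_operator K G H S
  for K :: "complex set" and X :: "'a::ab_group_add hilbert" and Y :: "'b::ab_group_add hilbert"
    and T :: "'a \<Rightarrow> 'b" and e :: "nat \<Rightarrow> 'a"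
    and G :: "'c::ab_group_add hilbert" and H :: "'d::ab_group_add hilbert" and S :: "'c \<Rightarrow> 'd" +
  fixes d :: nat and \<sigma> :: "(nat \<Rightarrow> 'a) \<Rightarrow> 'c" and \<tau> :: "(nat \<Rightarrow> 'b) \<Rightarrow> 'd"
  assumes dom_tensor: "tensor_power K d X G \<sigma>"
    and cod_tensor: "tensor_power K d Y H \<tau>"
    and tensor_op: "tensor_power_op K d X T G \<sigma> H \<tau> S"
begin

section \<open>Elementary tensors and products of singular vectors\<close>

lemma \<sigma>_closed: "f \<in> {..<d} \<rightarrow> space\<^sub>H X \<Longrightarrow> \<sigma> f \<in> space\<^sub>H G"
  using dom_tensor funcset_mem[of \<sigma> "{..<d} \<rightarrow> space\<^sub>H X" "space\<^sub>H G" f]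
  unfolding tensor_power_def by simp

lemma inner_\<sigma>:
  assumes "f \<in> {..<d} \<rightarrow> space\<^sub>H X" "g \<in> {..<d} \<rightarrow> space\<^sub>H X"
  shows "inner\<^sub>H G (\<sigma> f) (\<sigma> g) = (\<Prod>i<d. inner\<^sub>H X (f i) (g i))"
  using dom_tensor assms unfolding tensor_power_def by simp

lemma inner_\<tau>:
  assumes "f \<in> {..<d} \<rightarrow> space\<^sub>H Y" "g \<in> {..<d} \<rightarrow> space\<^sub>H Y"
  shows "inner\<^sub>H H (\<tau> f) (\<tau> g) = (\<Prod>i<d. inner\<^sub>H Y (f i) (g i))"
  using cod_tensor assms unfolding tensor_power_def by simp

lemma inner_S_\<sigma>:
  assumes "f \<in> {..<d} \<rightarrow> space\<^sub>H X" "g \<in> {..<d} \<rightarrow> space\<^sub>H X"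
  shows "inner\<^sub>H H (S (\<sigma> f)) (S (\<sigma> g)) = (\<Prod>i<d. inner\<^sub>H Y (T (f i)) (T (g i)))"
proof -
  have "S (\<sigma> f) = \<tau> (\<lambda>i. T (f i))" "S (\<sigma> g) = \<tau> (\<lambda>i. T (g i))"
    using tensor_op assms unfolding tensor_power_op_def by auto
  moreover have "(\<lambda>i. T (f i)) \<in> {..<d} \<rightarrow> space\<^sub>H Y" "(\<lambda>i. T (g i)) \<in> {..<d} \<rightarrow> space\<^sub>H Y"
    using assms by auto
  ultimately show ?thesis by (simp add: inner_\<tau>)
qed

definition tensor_e :: "(nat \<Rightarrow> nat) \<Rightarrow> 'c" where "tensor_e i = \<sigma> (\<lambda>j. e (i j))"

text \<open>Extensional functions, so that distinct multi-indices differ in one of the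
  \<open>d\<close> places.\<close>

abbreviation multi_indices :: "(nat \<Rightarrow> nat) set" where
  "multi_indices \<equiv> {..<d} \<rightarrow>\<^sub>E UNIV"

lemma tensor_e_closed [simp, intro]: "tensor_e i \<in> space\<^sub>H G"
  by (simp add: tensor_e_def \<sigma>_closed)

lemma inner_tensor_e: "inner\<^sub>H G (tensor_e i) (tensor_e k) = (\<Prod>j<d. inner\<^sub>H X (e (i j)) (e (k j)))"
  unfolding tensor_e_def by (rule inner_\<sigma>) auto

lemma inner_S_tensor_e:
  "inner\<^sub>H H (S (tensor_e i)) (S (tensor_e k)) = (\<Prod>j<d. inner\<^sub>H Y (T (e (i j))) (T (e (k j))))"
  unfolding tensor_e_def by (rule inner_S_\<sigma>) auto

lemma multi_indices_neq:
  assumes "i \<in> multi_indices" "k \<in> multi_indices" "i \<noteq> k"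
  shows "\<exists>j\<in>{..<d}. i j \<noteq> k j"
  using PiE_ext[OF assms(1,2)] assms(3) by blast

lemma inner_tensor_e_neq:
  assumes "i \<in> multi_indices" "k \<in> multi_indices" "i \<noteq> k"
  shows "inner\<^sub>H G (tensor_e i) (tensor_e k) = 0"
  unfolding inner_tensor_e using multi_indices_neq[OF assms] base.inner_e_neq
  by (intro prod_zero) auto

lemma inner_S_tensor_e_neq:
  assumes "i \<in> multi_indices" "k \<in> multi_indices" "i \<noteq> k"
  shows "inner\<^sub>H H (S (tensor_e i)) (S (tensor_e k)) = 0"
  unfolding inner_S_tensor_e using multi_indices_neq[OF assms] base.inner_image_neq
  by (intro prod_zero) auto

lemma norm_tensor_e:
  assumes "\<And>j. j < d \<Longrightarrow> norm\<^sub>H X (e (i j)) = 1"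
  shows "norm\<^sub>H G (tensor_e i) = 1"
proof -
  have "inner\<^sub>H G (tensor_e i) (tensor_e i) = (\<Prod>j<d. 1)"
    unfolding inner_tensor_e using assms by (intro prod.cong refl) (simp add: base.dom.inner_self)
  then have "(norm\<^sub>H G (tensor_e i))\<^sup>2 = 1"
    by (subst big.dom.norm_square[OF tensor_e_closed]) simp
  then show ?thesis
    using big.dom.norm_nonneg[OF tensor_e_closed[of i]] unfolding power2_eq_1_iff by linarith
qed

text \<open>A product with a zero factor vanishes, because its inner product with itself has a zero
  factor; all other products are unit vectors.\<close>

lemma orthonormal_tensor_e:
  assumes "I \<subseteq> multi_indices" shows "orthonormal_or_zero G I tensor_e"
  unfolding orthonormal_or_zero_def
proof (intro conjI ballI impI)
  fix i
  show "tensor_e i = 0 \<or> norm\<^sub>H G (tensor_e i) = 1"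
  proof (cases "\<exists>j<d. e (i j) = 0")
    case True
    then obtain j where "j < d" "inner\<^sub>H X (e (i j)) (e (i j)) = 0"
      using base.dom.inner_zero[OF base.dom.zero_closed] by auto
    then have "inner\<^sub>H G (tensor_e i) (tensor_e i) = 0"
      unfolding inner_tensor_e by (intro prod_zero) auto
    then show ?thesis using big.dom.inner_pos[of "tensor_e i"] by auto
  next
    case False
    then show ?thesis using base.e_norm by (intro disjI2 norm_tensor_e) blast
  qed
qed (use assms in \<open>auto intro: inner_tensor_e_neq\<close>)

lemma norm_S_tensor_e: "norm\<^sub>H H (S (tensor_e i)) = (\<Prod>j<d. base.sval (i j))"
proof (rule power2_eq_imp_eq)
  have "complex_of_real ((norm\<^sub>H H (S (tensor_e i)))\<^sup>2) = of_real ((\<Prod>j<d. base.sval (i j))\<^sup>2)"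
    using inner_S_tensor_e[of i i]
    by (simp add: big.cod.inner_self base.cod.inner_self base.sval_def prod_power_distrib)
  then show "(norm\<^sub>H H (S (tensor_e i)))\<^sup>2 = (\<Prod>j<d. base.sval (i j))\<^sup>2" by (simp only: of_real_eq_iff)
qed (auto intro!: prod_nonneg)

section \<open>Truncation to cubes of multi-indices\<close>

definition cube :: "nat \<Rightarrow> (nat \<Rightarrow> nat) set" where "cube n = {..<d} \<rightarrow>\<^sub>E {..<n}"

lemma finite_cube [simp]: "finite (cube n)"
  unfolding cube_def by (intro finite_PiE) auto

lemma cube_subset: "cube n \<subseteq> multi_indices"
  unfolding cube_def by (intro PiE_mono) auto

lemma subset_cube:
  assumes "finite F" "F \<subseteq> multi_indices"
  obtains N where "\<And>n. n \<ge> N \<Longrightarrow> F \<subseteq> cube n"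
proof -
  have "finite ((\<lambda>(i, j). i j) ` (F \<times> {..<d}))" using assms by auto
  then obtain N where "(\<lambda>(i, j). i j) ` (F \<times> {..<d}) \<subseteq> {..<N}"
    using finite_nat_iff_bounded by blast
  then have "F \<subseteq> cube n" if "n \<ge> N" for n
    using assms(2) that by (fastforce simp: cube_def PiE_iff)
  then show thesis using that by blast
qed

text \<open>What the truncation to a cube loses in the image. Cubes are used because a sum of
  products over a cube factors into \<open>d\<close> single sums.\<close>

definition cube_residual :: "nat \<Rightarrow> 'c \<Rightarrow> 'd" where
  "cube_residual n x = S x - S (proj\<^sub>H G (cube n) tensor_e x)"

lemma cube_proj_closed: "x \<in> space\<^sub>H G \<Longrightarrow> proj\<^sub>H G (cube n) tensor_e x \<in> space\<^sub>H G"
  using big.dom.proj_closed[OF orthonormal_tensor_e[OF cube_subset]] .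

lemma cube_residual_closed: "x \<in> space\<^sub>H G \<Longrightarrow> cube_residual n x \<in> space\<^sub>H H"
  by (simp add: cube_residual_def cube_proj_closed)

text \<open>
  On an elementary tensor the squared residual is the difference of two products of squared
  norms, so it tends to zero by Parseval's identity in every factor.
\<close>

lemma cube_residual_elementary:
  assumes f: "f \<in> {..<d} \<rightarrow> space\<^sub>H X" and s: "base.sval \<longlonglongrightarrow> 0"
  shows "(\<lambda>n. norm\<^sub>H H (cube_residual n (\<sigma> f))) \<longlonglongrightarrow> 0"
proof -
  have fX: "f j \<in> space\<^sub>H X" if "j < d" for j using f that by auto
  define c where "c i = inner\<^sub>H G (\<sigma> f) (tensor_e i)" for i
  have c: "c i = (\<Prod>j<d. inner\<^sub>H X (f j) (e (i j)))" for i
    unfolding c_def tensor_e_def using f by (intro inner_\<sigma>) auto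
  have norm_S: "(norm\<^sub>H H (S (\<sigma> f)))\<^sup>2 = (\<Prod>j<d. (norm\<^sub>H Y (T (f j)))\<^sup>2)"
  proof -
    have "complex_of_real ((norm\<^sub>H H (S (\<sigma> f)))\<^sup>2) = of_real (\<Prod>j<d. (norm\<^sub>H Y (T (f j)))\<^sup>2)"
      using inner_S_\<sigma>[OF f f] \<sigma>_closed[OF f] fX
      by (simp add: big.cod.inner_self base.cod.inner_self)
    then show ?thesis by (simp only: of_real_eq_iff)
  qed
  have eq: "(norm\<^sub>H H (cube_residual n (\<sigma> f)))\<^sup>2 = (norm\<^sub>H H (S (\<sigma> f)))\<^sup>2
      - (\<Prod>j<d. \<Sum>k<n. (cmod (inner\<^sub>H X (f j) (e k)))\<^sup>2 * (base.sval k)\<^sup>2)" for n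
  proof -
    have "(norm\<^sub>H H (cube_residual n (\<sigma> f)))\<^sup>2 = (norm\<^sub>H H (S (\<sigma> f)))\<^sup>2
        - (\<Sum>i\<in>cube n. (cmod (c i))\<^sup>2 * (norm\<^sub>H H (S (tensor_e i)))\<^sup>2)"
      unfolding cube_residual_def big.map_proj[OF orthonormal_tensor_e[OF cube_subset] \<sigma>_closed[OF f]]
        c_def[symmetric]
    proof (rule big.cod.norm_residual_orthogonal)
      fix i assume "i \<in> cube n"
      have "inner\<^sub>H H (S (\<sigma> f)) (S (tensor_e i)) = (\<Prod>j<d. inner\<^sub>H Y (T (f j)) (T (e (i j))))"
        unfolding tensor_e_def using f by (intro inner_S_\<sigma>) auto
      \<comment> \<open>\<open>inner_image\<close> in each factor: \<open>c i\<close> is the Fourier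
        coefficient of \<open>S (\<sigma> f)\<close> with respect to the image of
        \<open>tensor_e i\<close>.\<close>
      also have "\<dots> = (\<Prod>j<d. inner\<^sub>H X (f j) (e (i j)) * inner\<^sub>H Y (T (e (i j))) (T (e (i j))))"
        using fX by (intro prod.cong refl) (simp add: base.inner_image base.cod.inner_self base.sval_def)
      also have "\<dots> = c i * inner\<^sub>H H (S (tensor_e i)) (S (tensor_e i))"
        by (simp add: prod.distrib c inner_S_tensor_e)
      finally show "inner\<^sub>H H (S (\<sigma> f)) (S (tensor_e i))
          = c i * inner\<^sub>H H (S (tensor_e i)) (S (tensor_e i))" .
      show "c i \<in> K" using \<sigma>_closed[OF f] by (simp add: c_def)
    next
      fix i k assume "i \<in> cube n" "k \<in> cube n" "i \<noteq> k"
      then show "inner\<^sub>H H (S (tensor_e i)) (S (tensor_e k)) = 0"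
        using cube_subset by (intro inner_S_tensor_e_neq) auto
    qed (use \<sigma>_closed[OF f] in auto)
    also have "(\<Sum>i\<in>cube n. (cmod (c i))\<^sup>2 * (norm\<^sub>H H (S (tensor_e i)))\<^sup>2)
        = (\<Sum>i\<in>cube n. \<Prod>j<d. (cmod (inner\<^sub>H X (f j) (e (i j))))\<^sup>2 * (base.sval (i j))\<^sup>2)"
      by (simp add: c norm_S_tensor_e prod.distrib prod_power_distrib flip: prod_norm)
    \<comment> \<open>The distributive law turns the sum over the cube into a product of partial
      Parseval sums, one for each factor.\<close>
    also have "\<dots> = (\<Prod>j<d. \<Sum>k<n. (cmod (inner\<^sub>H X (f j) (e k)))\<^sup>2 * (base.sval k)\<^sup>2)"
      unfolding cube_def by (subst prod_sum_PiE) auto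
    finally show ?thesis .
  qed
  have "(\<lambda>n. \<Prod>j<d. \<Sum>k<n. (cmod (inner\<^sub>H X (f j) (e k)))\<^sup>2 * (base.sval k)\<^sup>2)
      \<longlonglongrightarrow> (\<Prod>j<d. (norm\<^sub>H Y (T (f j)))\<^sup>2)"
    using fX base.parseval[OF _ s] by (intro tendsto_prod) auto
  then have "(\<lambda>n. (norm\<^sub>H H (cube_residual n (\<sigma> f)))\<^sup>2) \<longlonglongrightarrow> (norm\<^sub>H H (S (\<sigma> f)))\<^sup>2 - (norm\<^sub>H H (S (\<sigma> f)))\<^sup>2"
    unfolding eq norm_S by (intro tendsto_diff tendsto_const)
  then have "(\<lambda>n. sqrt ((norm\<^sub>H H (cube_residual n (\<sigma> f)))\<^sup>2)) \<longlonglongrightarrow> sqrt 0"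
    by (intro tendsto_real_sqrt) simp
  then show ?thesis using \<sigma>_closed[OF f] by (simp add: cube_residual_closed)
qed

text \<open>The residual is linear in its argument, so convergence passes from elementary tensors to
  finite combinations by the triangle inequality.\<close>

lemma cube_residual_span:
  assumes s: "base.sval \<longlonglongrightarrow> 0" and x: "x \<in> span\<^sub>H K G (\<sigma> ` ({..<d} \<rightarrow> space\<^sub>H X))"
  shows "x \<in> space\<^sub>H G \<and> (\<lambda>n. norm\<^sub>H H (cube_residual n x)) \<longlonglongrightarrow> 0"
proof -
  obtain F c where F: "finite F" "F \<subseteq> \<sigma> ` ({..<d} \<rightarrow> space\<^sub>H X)" "c \<in> F \<rightarrow> K"
    and x_eq: "x = (\<Sum>b\<in>F. scale\<^sub>H G (c b) b)"
    using x unfolding span\<^sub>H_def by blast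
  have "(\<Sum>b\<in>F. scale\<^sub>H G (c b) b) \<in> space\<^sub>H G \<and>
      (\<lambda>n. norm\<^sub>H H (cube_residual n (\<Sum>b\<in>F. scale\<^sub>H G (c b) b))) \<longlonglongrightarrow> 0"
    using F
  proof (induction F rule: finite_induct)
    case empty
    have "proj\<^sub>H G (cube n) tensor_e 0 = 0" for n
      unfolding proj\<^sub>H_def by (intro sum.neutral) (auto simp: big.dom.inner_zero)
    then show ?case by (simp add: cube_residual_def)
  next
    case (insert b F)
    define y where "y = (\<Sum>b\<in>F. scale\<^sub>H G (c b) b)"
    have y: "y \<in> space\<^sub>H G" "(\<lambda>n. norm\<^sub>H H (cube_residual n y)) \<longlonglongrightarrow> 0"
      unfolding y_def using insert.IH insert.prems by auto
    obtain f where f: "f \<in> {..<d} \<rightarrow> space\<^sub>H X" "b = \<sigma> f" using insert.prems by blast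
    then have b: "b \<in> space\<^sub>H G" by (simp add: \<sigma>_closed)
    have cb: "c b \<in> K" using insert.prems by auto
    note on = orthonormal_tensor_e[OF cube_subset]
    have res: "cube_residual n (scale\<^sub>H G (c b) b + y)
        = scale\<^sub>H H (c b) (cube_residual n b) + cube_residual n y" for n
      using b cb y(1) cube_proj_closed
      by (simp add: cube_residual_def big.dom.proj_add[OF on] big.dom.proj_scale[OF on]
          big.map_add big.map_scale big.cod.scale_diff_right)
    have "(\<lambda>n. norm\<^sub>H H (cube_residual n (scale\<^sub>H G (c b) b + y))) \<longlonglongrightarrow> 0"
    proof (rule tendsto_sandwich[of "\<lambda>_. 0" _ _
          "\<lambda>n. cmod (c b) * norm\<^sub>H H (cube_residual n b) + norm\<^sub>H H (cube_residual n y)"])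
      have "norm\<^sub>H H (cube_residual n (scale\<^sub>H G (c b) b + y))
          \<le> cmod (c b) * norm\<^sub>H H (cube_residual n b) + norm\<^sub>H H (cube_residual n y)" for n
        using big.cod.norm_triangle[of "scale\<^sub>H H (c b) (cube_residual n b)" "cube_residual n y"]
          b cb y(1) by (simp add: res cube_residual_closed big.cod.norm_scale)
      then show "\<forall>\<^sub>F n in sequentially. norm\<^sub>H H (cube_residual n (scale\<^sub>H G (c b) b + y))
          \<le> cmod (c b) * norm\<^sub>H H (cube_residual n b) + norm\<^sub>H H (cube_residual n y)" by simp
      have "(\<lambda>n. cmod (c b) * norm\<^sub>H H (cube_residual n b) + norm\<^sub>H H (cube_residual n y))
          \<longlonglongrightarrow> cmod (c b) * 0 + 0"
        using cube_residual_elementary[OF f(1) s] f(2) by (intro tendsto_intros y(2)) simp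
      then show "(\<lambda>n. cmod (c b) * norm\<^sub>H H (cube_residual n b) + norm\<^sub>H H (cube_residual n y))
          \<longlonglongrightarrow> 0" by simp
    qed (use b cb y(1) in \<open>auto simp: cube_residual_closed\<close>)
    then show ?case using insert.hyps b cb y(1) by (simp add: y_def)
  qed
  then show ?thesis by (simp add: x_eq)
qed

text \<open>Inside a large cube the part outside \<open>F\<close> consists of orthogonal terms with
  factors at most \<open>\<delta>\<close>, so Bessel bounds it. Letting the cube grow gives the
  claim on the span of elementary tensors, and density with boundedness extends it to all of
  \<open>G\<close>.\<close>

lemma residual_le:
  assumes s: "base.sval \<longlonglongrightarrow> 0" and F: "finite F" "F \<subseteq> multi_indices"
    and \<delta>: "0 \<le> \<delta>" "\<And>i. i \<in> multi_indices - F \<Longrightarrow> (\<Prod>j<d. base.sval (i j)) \<le> \<delta>"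
    and x: "x \<in> space\<^sub>H G"
  shows "norm\<^sub>H H (S x - S (proj\<^sub>H G F tensor_e x)) \<le> \<delta> * norm\<^sub>H G x"
proof -
  define R where "R x = S x - S (proj\<^sub>H G F tensor_e x)" for x
  note onF = orthonormal_tensor_e[OF F(2)]
  have P: "proj\<^sub>H G F tensor_e x \<in> space\<^sub>H G" if "x \<in> space\<^sub>H G" for x
    using big.dom.proj_closed[OF onF that] .
  have R_closed: "R x \<in> space\<^sub>H H" if "x \<in> space\<^sub>H G" for x using that P by (simp add: R_def)
  obtain N where N: "\<And>n. n \<ge> N \<Longrightarrow> F \<subseteq> cube n" using subset_cube[OF F] by blast
  have cube_step: "norm\<^sub>H H (R x) \<le> norm\<^sub>H H (cube_residual n x) + \<delta> * norm\<^sub>H G x"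
    if x: "x \<in> space\<^sub>H G" and n: "n \<ge> N" for x n
  proof -
    let ?c = "\<lambda>i. inner\<^sub>H G x (tensor_e i)"
    let ?D = "\<Sum>i\<in>cube n - F. scale\<^sub>H H (?c i) (S (tensor_e i))"
    have D: "?D \<in> space\<^sub>H H" using x by auto
    have "S (proj\<^sub>H G (cube n) tensor_e x) = S (proj\<^sub>H G F tensor_e x) + ?D"
      unfolding big.map_proj[OF orthonormal_tensor_e[OF cube_subset] x] big.map_proj[OF onF x]
      using sum.subset_diff[OF N[OF n] finite_cube] by (simp add: add.commute)
    then have R_eq: "R x = cube_residual n x + ?D" by (simp add: R_def cube_residual_def)
    have orth: "inner\<^sub>H H (S (tensor_e i)) (S (tensor_e k)) = 0"
      if "i \<in> cube n - F" "k \<in> cube n - F" "i \<noteq> k" for i k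
      using that cube_subset by (intro inner_S_tensor_e_neq) auto
    have "(norm\<^sub>H H ?D)\<^sup>2 = (\<Sum>i\<in>cube n - F. (cmod (?c i))\<^sup>2 * (norm\<^sub>H H (S (tensor_e i)))\<^sup>2)"
      using x orth by (intro big.cod.norm_lincomb_orthogonal) auto
    also have "\<dots> \<le> (\<Sum>i\<in>cube n - F. (cmod (?c i))\<^sup>2 * \<delta>\<^sup>2)"
    proof (intro sum_mono mult_left_mono power_mono)
      fix i assume "i \<in> cube n - F"
      then have "i \<in> multi_indices - F" using cube_subset by blast
      then show "norm\<^sub>H H (S (tensor_e i)) \<le> \<delta>" unfolding norm_S_tensor_e by (rule \<delta>(2))
    qed auto
    also have "\<dots> = (\<Sum>i\<in>cube n - F. (cmod (?c i))\<^sup>2) * \<delta>\<^sup>2" by (simp add: sum_distrib_right)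
    also have "\<dots> \<le> (\<Sum>i\<in>cube n. (cmod (?c i))\<^sup>2) * \<delta>\<^sup>2"
      by (intro mult_right_mono sum_mono2) auto
    also have "\<dots> = (norm\<^sub>H G (proj\<^sub>H G (cube n) tensor_e x))\<^sup>2 * \<delta>\<^sup>2"
      using big.dom.norm_proj_square[OF orthonormal_tensor_e[OF cube_subset] finite_cube x] by simp
    also have "\<dots> \<le> (norm\<^sub>H G x)\<^sup>2 * \<delta>\<^sup>2"
      using big.dom.bessel(1)[OF orthonormal_tensor_e[OF cube_subset] finite_cube x]
        cube_proj_closed[OF x] by (intro mult_right_mono power_mono) auto
    also have "\<dots> = (\<delta> * norm\<^sub>H G x)\<^sup>2" by (simp add: power_mult_distrib)
    finally have "norm\<^sub>H H ?D \<le> \<delta> * norm\<^sub>H G x"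
      by (rule power2_le_imp_le) (use \<delta>(1) x in simp)
    then show ?thesis
      unfolding R_eq using big.cod.norm_triangle[OF cube_residual_closed[OF x] D, of n] by linarith
  qed
  have span_bound: "norm\<^sub>H H (R y) \<le> \<delta> * norm\<^sub>H G y"
    if "y \<in> span\<^sub>H K G (\<sigma> ` ({..<d} \<rightarrow> space\<^sub>H X))" for y
  proof -
    have y: "y \<in> space\<^sub>H G" "(\<lambda>n. norm\<^sub>H H (cube_residual n y)) \<longlonglongrightarrow> 0"
      using cube_residual_span[OF s that] by auto
    have "(\<lambda>n. norm\<^sub>H H (cube_residual n y) + \<delta> * norm\<^sub>H G y) \<longlonglongrightarrow> 0 + \<delta> * norm\<^sub>H G y"
      by (intro tendsto_add y(2) tendsto_const)
    then show ?thesis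
      using cube_step[OF y(1)] by (intro LIMSEQ_le_const[of _ "\<delta> * norm\<^sub>H G y"]) auto
  qed
  obtain C where C: "0 < C" "\<And>x. x \<in> space\<^sub>H G \<Longrightarrow> norm\<^sub>H H (S x) \<le> C * norm\<^sub>H G x"
    using big.norm_bound by blast
  \<comment> \<open>A crude bound suffices here: it is only applied to the small difference
    \<open>x - y\<close>.\<close>
  have R_bound: "norm\<^sub>H H (R z) \<le> 2 * C * norm\<^sub>H G z" if z: "z \<in> space\<^sub>H G" for z
  proof -
    have "norm\<^sub>H H (R z) \<le> norm\<^sub>H H (S z) + norm\<^sub>H H (S (proj\<^sub>H G F tensor_e z))"
      using big.cod.norm_triangle[of "S z" "- S (proj\<^sub>H G F tensor_e z)"] P[OF z] z
      by (simp add: R_def big.cod.norm_minus)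
    moreover have "C * norm\<^sub>H G (proj\<^sub>H G F tensor_e z) \<le> C * norm\<^sub>H G z"
      using big.dom.bessel(1)[OF onF F(1) z] C(1) by (intro mult_left_mono) auto
    ultimately show ?thesis using C(2)[OF z] C(2)[OF P[OF z]] by linarith
  qed
  have "norm\<^sub>H H (R x) \<le> \<delta> * norm\<^sub>H G x + \<epsilon>" if \<epsilon>: "0 < \<epsilon>" for \<epsilon>
  proof -
    \<comment> \<open>Replacing \<open>x\<close> by \<open>y\<close> costs at most
      \<open>\<delta> * r\<close> in the bound on the span and \<open>2 * C * r\<close> for the
      difference, in total \<open>\<epsilon>\<close>.\<close>
    define r where "r = \<epsilon> / (\<delta> + 2 * C)"
    have "0 < \<delta> + 2 * C" using \<delta>(1) C(1) by simp
    then have r: "0 < r" "(\<delta> + 2 * C) * r = \<epsilon>"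
      using \<epsilon> by (simp_all add: r_def)
    obtain y where y: "y \<in> span\<^sub>H K G (\<sigma> ` ({..<d} \<rightarrow> space\<^sub>H X))" "y \<in> space\<^sub>H G" "norm\<^sub>H G (x - y) < r"
      using big.dom.dense_approx[OF _ x r(1)] dom_tensor unfolding tensor_power_def by metis
    have xy: "x - y \<in> space\<^sub>H G" using x y by simp
    have "proj\<^sub>H G F tensor_e x = proj\<^sub>H G F tensor_e y + proj\<^sub>H G F tensor_e (x - y)"
      using big.dom.proj_add[OF onF y(2) xy] by simp
    then have R_sum: "R x = R y + R (x - y)"
      using P[OF y(2)] P[OF xy] x y(2) by (simp add: R_def big.map_add big.map_diff)
    have "norm\<^sub>H G y \<le> norm\<^sub>H G x + norm\<^sub>H G (x - y)"
      using big.dom.norm_diff_triangle[OF y(2) x] big.dom.norm_diff_commute[OF x y(2)] by simp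
    then have "\<delta> * norm\<^sub>H G y \<le> \<delta> * (norm\<^sub>H G x + r)"
      using y(3) \<delta>(1) by (intro mult_left_mono) auto
    moreover have "2 * C * norm\<^sub>H G (x - y) \<le> 2 * C * r"
      using y(3) C(1) by (intro mult_left_mono) auto
    moreover have "norm\<^sub>H H (R x) \<le> norm\<^sub>H H (R y) + norm\<^sub>H H (R (x - y))"
      unfolding R_sum using R_closed y(2) xy by (intro big.cod.norm_triangle) auto
    moreover have "\<delta> * (norm\<^sub>H G x + r) = \<delta> * norm\<^sub>H G x + \<delta> * r" by (simp add: distrib_left)
    ultimately show ?thesis
      using span_bound[OF y(1)] R_bound[OF xy] r(2)[unfolded distrib_right] by linarith
  qed
  then have "norm\<^sub>H H (R x) \<le> \<delta> * norm\<^sub>H G x" by (rule field_le_epsilon)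
  then show ?thesis by (simp add: R_def)
qed

section \<open>Approximation numbers of the tensor power\<close>

lemma tensor_approx_number_le:
  assumes "base.sval \<longlonglongrightarrow> 0" "finite F" "F \<subseteq> multi_indices" "card F < m" "0 \<le> \<delta>"
    and "\<And>i. i \<in> multi_indices - F \<Longrightarrow> (\<Prod>j<d. base.sval (i j)) \<le> \<delta>"
  shows "approx_number K G H S m \<le> \<delta>"
proof (rule big.approx_number_le[OF orthonormal_tensor_e[OF assms(3)] assms(2,4) _ assms(5)])
  fix i j assume "i \<in> F" "j \<in> F" "i \<noteq> j"
  then show "inner\<^sub>H H (S (tensor_e i)) (S (tensor_e j)) = 0"
    using assms(3) by (intro inner_S_tensor_e_neq) auto
qed (use residual_le[OF assms(1-3,5,6)] in auto)

text \<open>Each set \<open>A\<close> of \<open>k\<close> of the \<open>d\<close> factors gives a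
  product vector with \<open>e 1\<close> in the places of \<open>A\<close> and \<open>e 0\<close>
  elsewhere. These are orthonormal, with orthogonal images of norm
  \<open>base.sval 1 ^ k\<close>.\<close>

lemma tensor_approx_number_ge:
  assumes "base.sval 0 = 1" "1 \<le> k" "1 \<le> m" "m \<le> d choose k"
  shows "base.sval 1 ^ k \<le> approx_number K G H S m"
proof (cases "base.sval 1 = 0")
  \<comment> \<open>Here \<open>e 1\<close> may be the zero vector, so the product vectors need not
    be normalised; the bound is trivial because \<open>k\<close> is positive.\<close>
  case True
  then have "base.sval 1 ^ k = 0" using assms(2) by simp
  then show ?thesis using big.approx_number_nonneg[OF assms(3)] by linarith
next
  case False
  define \<A> where "\<A> = {A. A \<subseteq> {..<d} \<and> card A = k}"
  define i where "i A = (\<lambda>j\<in>{..<d}. if j \<in> A then 1 else 0 :: nat)" for A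
  have i_mem: "i A \<in> multi_indices" for A by (simp add: i_def)
  have i_neq: "i A \<noteq> i B" if "A \<in> \<A>" "B \<in> \<A>" "A \<noteq> B" for A B
  proof
    assume eq: "i A = i B"
    have "j \<in> A \<longleftrightarrow> j \<in> B" if "j < d" for j
      using fun_cong[OF eq, of j] that by (auto simp: i_def split: if_splits)
    then show False using \<open>A \<noteq> B\<close> \<open>A \<in> \<A>\<close> \<open>B \<in> \<A>\<close> by (auto simp: \<A>_def)
  qed
  have norm_S: "norm\<^sub>H H (S (tensor_e (i A))) = base.sval 1 ^ k" if "A \<in> \<A>" for A
  proof -
    have "(\<Prod>j<d. base.sval (i A j)) = (\<Prod>j<d. if j \<in> A then base.sval 1 else 1)"
      using assms(1) by (intro prod.cong) (auto simp: i_def)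
    also have "\<dots> = (\<Prod>j\<in>{..<d} \<inter> A. base.sval 1)"
      by (rule prod.inter_restrict[symmetric]) simp
    also have "{..<d} \<inter> A = A" using that by (auto simp: \<A>_def)
    finally show ?thesis using that by (simp add: norm_S_tensor_e \<A>_def)
  qed
  show ?thesis
  proof (rule big.approx_number_ge[of \<A> m "\<lambda>A. tensor_e (i A)"])
    show "finite \<A>" by (simp add: \<A>_def)
    show "m \<le> card \<A>" using assms(4) by (simp add: \<A>_def n_subsets)
    show "norm\<^sub>H G (tensor_e (i A)) = 1" for A
    proof (rule norm_tensor_e, rule base.norm_e)
      show "base.sval (i A j) \<noteq> 0" if "j < d" for j using False assms(1) that by (simp add: i_def)
    qed
    show "inner\<^sub>H G (tensor_e (i A)) (tensor_e (i B)) = 0"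
      and "inner\<^sub>H H (S (tensor_e (i A))) (S (tensor_e (i B))) = 0"
      if "A \<in> \<A>" "B \<in> \<A>" "A \<noteq> B" for A B
      using i_neq[OF that] i_mem by (auto intro: inner_tensor_e_neq inner_S_tensor_e_neq)
  qed (use assms norm_S in auto)
qed

end

text \<open>Collects what the tractability proof needs, in terms of approximation numbers alone: the
  singular system no longer appears. The sequence \<open>a\<close> starts at index 0.\<close>

lemma tensor_power_approx_numbers:
  fixes K :: "complex set" and X :: "'a::ab_group_add hilbert" and Y :: "'b::ab_group_add hilbert"
    and G :: "'c::ab_group_add hilbert" and H :: "'d::ab_group_add hilbert"
  assumes X: "hilbert_space K X" and Y: "hilbert_space K Y" and T: "compact_op K X Y T"
    and norm: "op_norm X Y T = 1"
    and G: "tensor_power K d X G \<sigma>" and H: "tensor_power K d Y H \<tau>"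
    and S: "tensor_power_op K d X T G \<sigma> H \<tau> S"
  defines "a \<equiv> \<lambda>n. approx_number K X Y T (Suc n)"
  shows "a 0 = 1"
    and "0 \<le> a n" "m \<le> n \<Longrightarrow> a n \<le> a m"
    and "\<lbrakk>a \<longlonglongrightarrow> 0; 0 \<le> \<delta>; finite {i \<in> {..<d} \<rightarrow>\<^sub>E UNIV. \<delta> < (\<Prod>j<d. a (i j))};
      card {i \<in> {..<d} \<rightarrow>\<^sub>E UNIV. \<delta> < (\<Prod>j<d. a (i j))} < m\<rbrakk> \<Longrightarrow> approx_number K G H S m \<le> \<delta>"
    and "\<lbrakk>1 \<le> k; 1 \<le> m; m \<le> d choose k\<rbrakk> \<Longrightarrow> a 1 ^ k \<le> approx_number K G H S m"
proof -
  interpret compact_operator K X Y T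
    using X Y T
    by (simp add: compact_operator_def compact_operator_axioms_def bounded_operator_def
        bounded_operator_axioms_def compact_op_def)
  obtain e where "singular_system K X Y T e" using singular_system_exists by blast
  then interpret tensor_singular_system K X Y T e G H S d \<sigma> \<tau>
    using G H S
    by (simp add: tensor_singular_system_def tensor_singular_system_axioms_def bounded_operator_def
        bounded_operator_axioms_def tensor_power_def tensor_power_op_def)
  have a: "a = base.sval" by (simp add: a_def base.approx_number_Suc fun_eq_iff)
  show a0: "a 0 = 1" using norm by (simp add: a base.sval_0)
  show "0 \<le> a n" by (simp add: a)
  show "a n \<le> a m" if "m \<le> n" using base.sval_antimono[OF that] by (simp add: a)
  show "approx_number K G H S m \<le> \<delta>"
    if "a \<longlonglongrightarrow> 0" "0 \<le> \<delta>" "finite {i \<in> {..<d} \<rightarrow>\<^sub>E UNIV. \<delta> < (\<Prod>j<d. a (i j))}"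
      "card {i \<in> {..<d} \<rightarrow>\<^sub>E UNIV. \<delta> < (\<Prod>j<d. a (i j))} < m"
    using that unfolding a
    by (intro tensor_approx_number_le[of "{i \<in> {..<d} \<rightarrow>\<^sub>E UNIV. \<delta> < (\<Prod>j<d. base.sval (i j))}"])
      (auto simp: not_less)
  show "a 1 ^ k \<le> approx_number K G H S m" if "1 \<le> k" "1 \<le> m" "m \<le> d choose k"
    using tensor_approx_number_ge[OF _ that] a0 by (simp add: a)
qed

section \<open>Counting large products\<close>

text \<open>All factors are at most 1, so a product is at most each of its factors; a product above
  \<open>\<delta>\<close> has no index beyond the point where \<open>s\<close> stays below
  \<open>\<delta>\<close>.\<close>

lemma large_products_bounded:
  fixes s :: "nat \<Rightarrow> real" and d :: nat
  assumes s: "\<And>n. 0 \<le> s n" "\<And>n. s n \<le> 1" "s \<longlonglongrightarrow> 0" and \<delta>: "0 < \<delta>"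
  shows "\<exists>N. {i \<in> {..<d} \<rightarrow>\<^sub>E UNIV. \<delta> < (\<Prod>j<d. s (i j))} \<subseteq> {..<d} \<rightarrow>\<^sub>E {..<N}"
proof -
  have "\<forall>\<^sub>F n in sequentially. s n < \<delta>" using order_tendstoD(2)[OF s(3) \<delta>] .
  then obtain N where N: "\<And>n. n \<ge> N \<Longrightarrow> s n < \<delta>" by (auto simp: eventually_sequentially)
  have "i j < N" if "\<delta> < (\<Prod>j<d. s (i j))" "j < d" for i j
  proof (rule ccontr)
    assume "\<not> i j < N"
    then have "s (i j) < \<delta>" using N by simp
    moreover have "(\<Prod>j<d. s (i j)) = s (i j) * (\<Prod>j\<in>{..<d} - {j}. s (i j))"
      using that by (subst prod.remove[of _ j]) auto
    moreover have "(\<Prod>j\<in>{..<d} - {j}. s (i j)) \<le> 1" by (intro prod_le_1) (auto simp: s)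
    then have "s (i j) * (\<Prod>j\<in>{..<d} - {j}. s (i j)) \<le> s (i j)"
      using s(1)[of "i j"] by (intro mult_left_le)
    ultimately show False using that by simp
  qed
  then show ?thesis by (intro exI[of _ N]) (auto simp: PiE_def)
qed

text \<open>Markov's inequality for the \<open>r\<close>-th powers: every counted product
  contributes at least \<open>\<delta> powr r\<close>, and the sum of all products over a box
  factors into a \<open>d\<close>-th power.\<close>

lemma card_large_products:
  fixes s :: "nat \<Rightarrow> real" and d :: nat
  assumes s: "\<And>n. 0 \<le> s n" "\<And>n. s n \<le> 1" "s \<longlonglongrightarrow> 0" and \<delta>: "0 < \<delta>" and r: "0 \<le> r"
    and B: "\<And>n. (\<Sum>k<n. s k powr r) \<le> B"
  shows "real (card {i \<in> {..<d} \<rightarrow>\<^sub>E UNIV. \<delta> < (\<Prod>j<d. s (i j))}) * \<delta> powr r \<le> B ^ d"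
proof -
  define F where "F = {i \<in> {..<d} \<rightarrow>\<^sub>E UNIV. \<delta> < (\<Prod>j<d. s (i j))}"
  obtain N where N: "F \<subseteq> {..<d} \<rightarrow>\<^sub>E {..<N}"
    using large_products_bounded[OF s \<delta>] unfolding F_def by blast
  have fin: "finite ({..<d} \<rightarrow>\<^sub>E {..<N})" by (intro finite_PiE) auto
  have "real (card F) * \<delta> powr r = (\<Sum>i\<in>F. \<delta> powr r)" by simp
  also have "\<dots> \<le> (\<Sum>i\<in>F. \<Prod>j<d. s (i j) powr r)"
  proof (intro sum_mono)
    fix i assume "i \<in> F"
    then have "\<delta> powr r \<le> (\<Prod>j<d. s (i j)) powr r" using r \<delta> by (intro powr_mono2) (auto simp: F_def)
    then show "\<delta> powr r \<le> (\<Prod>j<d. s (i j) powr r)" by (simp add: prod_powr_distrib)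
  qed
  also have "\<dots> \<le> (\<Sum>i\<in>{..<d} \<rightarrow>\<^sub>E {..<N}. \<Prod>j<d. s (i j) powr r)"
    using fin N by (intro sum_mono2) (auto intro!: prod_nonneg)
  also have "\<dots> = (\<Prod>j<d. \<Sum>k<N. s k powr r)" by (subst prod_sum_PiE) auto
  also have "\<dots> = (\<Sum>k<N. s k powr r) ^ d" by simp
  also have "\<dots> \<le> B ^ d" using B by (intro power_mono sum_nonneg) auto
  finally show ?thesis by (simp add: F_def)
qed

text \<open>The exponent is split: the power \<open>2 / p\<^sub>1\<close> turns the decay in
  \<open>k\<close> into summable inverse squares, and the power \<open>1 / p\<^sub>2\<close> turns
  the decay in \<open>x\<close> into the factor \<open>1 / x\<close>. Only the leading term 1 is
  free of this factor. In the application \<open>x\<close> is the number \<open>d\<close> of tensor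
  factors.\<close>

lemma sum_powr_le_of_decay:
  fixes s :: "nat \<Rightarrow> real"
  assumes s: "\<And>n. 0 \<le> s n" "s 0 = 1"
    and C: "0 < C\<^sub>1" "0 < p\<^sub>1" "0 < C\<^sub>2" "0 < p\<^sub>2" "0 < x"
    and s1: "\<And>k. s k \<le> C\<^sub>1 * real (Suc k) powr (- p\<^sub>1)"
    and s2: "\<And>k. 1 \<le> k \<Longrightarrow> s k \<le> C\<^sub>2 * x powr (- p\<^sub>2)"
  shows "(\<Sum>k<n. s k powr (2 / p\<^sub>1 + 1 / p\<^sub>2))
    \<le> 1 + C\<^sub>1 powr (2 / p\<^sub>1) * C\<^sub>2 powr (1 / p\<^sub>2) * (pi\<^sup>2 / 6) / x"
proof -
  define c where "c = C\<^sub>1 powr (2 / p\<^sub>1) * C\<^sub>2 powr (1 / p\<^sub>2)"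
  have summand_le: "s k powr (2 / p\<^sub>1 + 1 / p\<^sub>2) \<le> (if k = 0 then 1 else 0) + c / x * (1 / (real k + 1)\<^sup>2)" for k
  proof (cases "k = 0")
    case True
    then show ?thesis using s C by (simp add: c_def)
  next
    case False
    have "s k powr (2 / p\<^sub>1) \<le> (C\<^sub>1 * real (Suc k) powr (- p\<^sub>1)) powr (2 / p\<^sub>1)"
      using s1 s(1) C by (intro powr_mono2) auto
    also have "\<dots> = C\<^sub>1 powr (2 / p\<^sub>1) * real (Suc k) powr (- 2)"
      using C by (simp add: powr_mult powr_powr)
    also have "real (Suc k) powr (- 2) = 1 / (real k + 1)\<^sup>2"
      by (simp add: powr_minus powr_numeral inverse_eq_divide add.commute)
    finally have 1: "s k powr (2 / p\<^sub>1) \<le> C\<^sub>1 powr (2 / p\<^sub>1) * (1 / (real k + 1)\<^sup>2)" .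
    have "s k powr (1 / p\<^sub>2) \<le> (C\<^sub>2 * x powr (- p\<^sub>2)) powr (1 / p\<^sub>2)"
      using s2[of k] s(1) C False by (intro powr_mono2) auto
    also have "\<dots> = C\<^sub>2 powr (1 / p\<^sub>2) * x powr (- 1)"
      using C by (simp add: powr_mult powr_powr)
    also have "x powr (- 1) = 1 / x" using C by (simp add: powr_minus inverse_eq_divide)
    finally have 2: "s k powr (1 / p\<^sub>2) \<le> C\<^sub>2 powr (1 / p\<^sub>2) * (1 / x)" .
    have "s k powr (2 / p\<^sub>1 + 1 / p\<^sub>2) = s k powr (2 / p\<^sub>1) * s k powr (1 / p\<^sub>2)" by (rule powr_add)
    also have "\<dots> \<le> (C\<^sub>1 powr (2 / p\<^sub>1) * (1 / (real k + 1)\<^sup>2)) * (C\<^sub>2 powr (1 / p\<^sub>2) * (1 / x))"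
      using 1 2 by (intro mult_mono) auto
    finally show ?thesis using False by (simp add: c_def mult.commute)
  qed
  have "(\<Sum>k<n. s k powr (2 / p\<^sub>1 + 1 / p\<^sub>2))
      \<le> (\<Sum>k<n. (if k = 0 then 1 else 0) + c / x * (1 / (real k + 1)\<^sup>2))"
    by (intro sum_mono summand_le)
  also have "\<dots> = (\<Sum>k<n. if k = 0 then 1 else 0) + c / x * (\<Sum>k<n. 1 / (real k + 1)\<^sup>2)"
    by (simp add: sum.distrib sum_distrib_left)
  also have "\<dots> \<le> 1 + c / x * (pi\<^sup>2 / 6)"
  proof (intro add_mono mult_left_mono)
    show "(\<Sum>k<n. 1 / (real k + 1)\<^sup>2) \<le> pi\<^sup>2 / 6"
      using sum_le_suminf[OF sums_summable[OF inverse_squares_sums], of "{..<n}"]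
        sums_unique[OF inverse_squares_sums] by (simp add: add.commute)
  qed (use C in \<open>auto simp: c_def\<close>)
  finally show ?thesis by (simp add: c_def)
qed

text \<open>The elementary bound of the binomial coefficient below by \<open>(d / k) ^ k\<close> is
  combined with the assumed upper bound and solved for \<open>\<alpha>\<close>.\<close>

lemma decay_of_choose_bound:
  fixes \<alpha> C p q q' :: real and d k :: nat
  assumes \<alpha>: "0 < \<alpha>" "\<alpha> \<le> 1" and C: "0 \<le> C" and k: "1 \<le> k" "k \<le> d" and q: "q \<le> q'" "0 < q'"
    and bound: "real (d choose k) \<le> C * (\<alpha> ^ k) powr (- q) * real d powr p"
  shows "\<alpha> \<le> (C * real k powr real k) powr (1 / (k * q')) * real d powr (- ((k - p) / (k * q')))"
proof -
  define Q where "Q = real k * q'"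
  have Q: "0 < Q" using k q by (simp add: Q_def)
  have d: "0 < real d" using k by simp
  have "(real d / real k) ^ k \<le> real (d choose k)" using k by (intro binomial_ge_n_over_k_pow_k)
  also have "\<dots> \<le> C * (\<alpha> ^ k) powr (- q) * real d powr p" by (rule bound)
  also have "(\<alpha> ^ k) powr (- q) = \<alpha> powr (real k * (- q))"
    using \<alpha> by (simp add: powr_powr flip: powr_realpow)
  \<comment> \<open>Since \<open>\<alpha>\<close> is at most 1, raising \<open>q\<close> to
    \<open>q'\<close> weakens the bound. This makes the exponent \<open>Q\<close> positive, so that
    the \<open>Q\<close>-th root can be taken.\<close>
  also have "C * \<alpha> powr (real k * (- q)) * real d powr p \<le> C * \<alpha> powr (- Q) * real d powr p"
    using \<alpha> C q k by (intro mult_right_mono mult_left_mono powr_mono') (auto simp: Q_def)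
  finally have "real d powr k / real k powr k \<le> C * \<alpha> powr (- Q) * real d powr p"
    using k d by (simp add: powr_realpow power_divide)
  then have "real d powr k \<le> C * \<alpha> powr (- Q) * real d powr p * real k powr k"
    using k by (simp add: divide_le_eq)
  then have "\<alpha> powr Q * real d powr k \<le> \<alpha> powr Q * (C * \<alpha> powr (- Q) * real d powr p * real k powr k)"
    by (intro mult_left_mono) auto
  also have "\<dots> = (\<alpha> powr Q * \<alpha> powr (- Q)) * (C * real k powr k * real d powr p)"
    by (simp only: mult_ac)
  also have "\<alpha> powr Q * \<alpha> powr (- Q) = 1" using \<alpha> by (simp flip: powr_add)
  finally have "\<alpha> powr Q \<le> C * real k powr k * real d powr p / real d powr k"
    using d by (simp add: pos_le_divide_eq)
  also have "\<dots> = C * real k powr k * real d powr (p - k)" by (simp add: powr_diff)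
  finally have "(\<alpha> powr Q) powr (1 / Q) \<le> (C * real k powr k * real d powr (p - k)) powr (1 / Q)"
    using Q by (intro powr_mono2) auto
  also have "(\<alpha> powr Q) powr (1 / Q) = \<alpha>" using \<alpha> Q by (simp add: powr_powr)
  also have "(C * real k powr k * real d powr (p - k)) powr (1 / Q)
      = (C * real k powr k) powr (1 / Q) * real d powr ((p - k) / Q)"
    using C by (simp add: powr_mult powr_powr)
  also have "(p - k) / Q = - ((k - p) / Q)" by (simp add: minus_divide_left)
  finally show ?thesis by (simp add: Q_def)
qed

text \<open>The values below \<open>k\<close> are at most 1 and are absorbed by the constant
  \<open>real k powr p\<close>; the final maximum with 1 makes the constant positive.\<close>

lemma decays_polynomiallyI_eventually:
  assumes p: "0 < p" and D: "\<And>d. d \<ge> k \<Longrightarrow> x d \<le> D * real d powr (- p)"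
    and le: "\<And>d. 1 \<le> d \<Longrightarrow> x d \<le> 1"
  shows "decays_polynomially x"
  unfolding decays_polynomially_def
proof (intro exI conjI allI impI)
  let ?D = "max (max D (real k powr p)) 1"
  show "0 < ?D" "0 < p" using p by auto
  fix m :: nat assume m: "1 \<le> m"
  show "x m \<le> ?D * real m powr (- p)"
  proof (cases "m \<ge> k")
    case True
    have "D * real m powr (- p) \<le> ?D * real m powr (- p)" by (intro mult_right_mono) auto
    then show ?thesis using D[OF True] by linarith
  next
    case False
    have "1 = real m powr p * real m powr (- p)" using m by (simp flip: powr_add)
    also have "\<dots> \<le> real k powr p * real m powr (- p)"
      using False p by (intro mult_right_mono powr_mono2) auto
    also have "\<dots> \<le> ?D * real m powr (- p)" by (intro mult_right_mono) auto
    finally show ?thesis using le[OF m] by linarith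
  qed
qed

theorem theorem5:
  fixes K :: "complex set"
    and X :: "nat \<Rightarrow> 'a::ab_group_add hilbert"
    and Y :: "nat \<Rightarrow> 'b::ab_group_add hilbert"
    and T :: "nat \<Rightarrow> 'a \<Rightarrow> 'b"
    and XT :: "nat \<Rightarrow> 'c::ab_group_add hilbert" and \<sigma> :: "nat \<Rightarrow> (nat \<Rightarrow> 'a) \<Rightarrow> 'c"
    and YT :: "nat \<Rightarrow> 'e::ab_group_add hilbert" and \<tau> :: "nat \<Rightarrow> (nat \<Rightarrow> 'b) \<Rightarrow> 'e"
    and TT :: "nat \<Rightarrow> 'c \<Rightarrow> 'e"
  assumes X: "\<And>d. d \<ge> 1 \<Longrightarrow> hilbert_space K (X d)"
    and Y: "\<And>d. d \<ge> 1 \<Longrightarrow> hilbert_space K (Y d)"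
    and compact: "\<And>d. d \<ge> 1 \<Longrightarrow> compact_op K (X d) (Y d) (T d)"
    and norm_one: "\<And>d. d \<ge> 1 \<Longrightarrow> op_norm (X d) (Y d) (T d) = 1"
    and XT: "\<And>d. d \<ge> 1 \<Longrightarrow> tensor_power K d (X d) (XT d) (\<sigma> d)"
    and YT: "\<And>d. d \<ge> 1 \<Longrightarrow> tensor_power K d (Y d) (YT d) (\<tau> d)"
    and TT: "\<And>d. d \<ge> 1 \<Longrightarrow>
          tensor_power_op K d (X d) (T d) (XT d) (\<sigma> d) (YT d) (\<tau> d) (TT d)"
    and mono: "\<And>n. n \<ge> 1 \<Longrightarrow> antimono_on {1..} (\<lambda>d. approx_number K (X d) (Y d) (T d) n)"
    and decay: "decays_polynomially (\<lambda>n. approx_number K (X 1) (Y 1) (T 1) n)"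
  shows "let N = (\<lambda>\<epsilon> d. information_complexity K (XT d) (YT d) (TT d) \<epsilon>) in
      (strongly_polynomially_tractable N \<longleftrightarrow> polynomially_tractable N) \<and>
      (polynomially_tractable N \<longleftrightarrow>
         decays_polynomially (\<lambda>d. approx_number K (X d) (Y d) (T d) 2))"
proof -
  \<comment> \<open>Indices are shifted: \<open>a d 1\<close> is the second approximation
    number.\<close>
  define a where "a d n = approx_number K (X d) (Y d) (T d) (Suc n)" for d n
  define b where "b d m = approx_number K (XT d) (YT d) (TT d) m" for d m
  define N where "N \<epsilon> d = information_complexity K (XT d) (YT d) (TT d) \<epsilon>" for \<epsilon> d
  define F where "F d \<delta> = {i \<in> {..<d} \<rightarrow>\<^sub>E UNIV. \<delta> < (\<Prod>j<d. a d (i j))}" for d and \<delta> :: real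
  note single = tensor_power_approx_numbers[OF X Y compact norm_one XT YT TT, folded a_def b_def]
  have a0: "a d 0 = 1" and a_nonneg: "0 \<le> a d n" and a_antimono: "m \<le> n \<Longrightarrow> a d n \<le> a d m"
    if "1 \<le> d" for d m n
    using single(1-3)[OF that that that that that that that] .
  have a_le_1: "a d n \<le> 1" if "1 \<le> d" for d n
    using a_antimono[OF that, of 0 n] a0[OF that] by simp
  obtain C\<^sub>1 p\<^sub>1 where p1: "0 < C\<^sub>1" "0 < p\<^sub>1" "\<And>k. a 1 k \<le> C\<^sub>1 * real (Suc k) powr (- p\<^sub>1)"
    using decay unfolding decays_polynomially_def a_def by force
  \<comment> \<open>Monotonicity in \<open>d\<close> compares each operator with the first one, so
    one polynomial bound in \<open>k\<close> serves all \<open>d\<close>.\<close>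
  have a_decay: "a d k \<le> C\<^sub>1 * real (Suc k) powr (- p\<^sub>1)" if "1 \<le> d" for d k
    using monotone_onD[OF mono[of "Suc k"], of 1 d] that p1(3)[of k] by (simp add: a_def)
  have a_lim: "a d \<longlonglongrightarrow> 0" if d: "1 \<le> d" for d
  proof (rule tendsto_sandwich[of "\<lambda>_. 0" _ _ "\<lambda>k. C\<^sub>1 * real (Suc k) powr (- p\<^sub>1)"])
    have "(\<lambda>k. real (Suc k) powr (- p\<^sub>1)) \<longlonglongrightarrow> 0"
      using p1(2) by (intro tendsto_neg_powr filterlim_compose[OF filterlim_real_sequentially filterlim_Suc]) auto
    then show "(\<lambda>k. C\<^sub>1 * real (Suc k) powr (- p\<^sub>1)) \<longlonglongrightarrow> 0" by (rule tendsto_mult_right_zero)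
  qed (use a_decay a_nonneg d in auto)
  have upper: "b d m \<le> \<delta>" if d: "1 \<le> d" and \<delta>: "0 < \<delta>" and m: "card (F d \<delta>) < m" for d m \<delta>
  proof -
    obtain M where "F d \<delta> \<subseteq> {..<d} \<rightarrow>\<^sub>E {..<M}"
      using large_products_bounded[of "a d", OF a_nonneg a_le_1 a_lim \<delta>] d unfolding F_def by blast
    then have "finite (F d \<delta>)" by (rule finite_subset) (auto intro: finite_PiE)
    then show ?thesis
      using \<delta> m unfolding F_def by (intro single(4)[OF d d d d d d d a_lim[OF d]]) auto
  qed
  have lower: "a d 1 ^ k \<le> b d m" if d: "1 \<le> d" and "1 \<le> k" "1 \<le> m" "m \<le> d choose k" for d k m
    using single(5)[OF d d d d d d d that(2-4)] .
  have N_eq: "N \<epsilon> d = (LEAST n. b d (Suc n) < \<epsilon>)" for \<epsilon> d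
    by (simp add: N_def information_complexity_def min_error_def b_def)
  \<comment> \<open>\<open>upper\<close> yields a weak inequality whereas the information complexity
    asks for a strict one, hence the threshold \<open>\<epsilon> / 2\<close>.\<close>
  have card_works: "b d (Suc (card (F d (\<epsilon> / 2)))) < \<epsilon>" if d: "1 \<le> d" and \<epsilon>: "0 < \<epsilon>" for \<epsilon> d
  proof -
    have "b d (Suc (card (F d (\<epsilon> / 2)))) \<le> \<epsilon> / 2" by (rule upper) (use d \<epsilon> in simp_all)
    then show ?thesis using \<epsilon> by linarith
  qed
  have N_upper: "N \<epsilon> d \<le> card (F d (\<epsilon> / 2))" if "1 \<le> d" "0 < \<epsilon>" for \<epsilon> d
    unfolding N_eq using card_works[OF that] by (rule Least_le)
  have N_error: "b d (Suc (N \<epsilon> d)) < \<epsilon>" if "1 \<le> d" "0 < \<epsilon>" for \<epsilon> d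
    unfolding N_eq using card_works[OF that] by (rule LeastI)
  \<comment> \<open>The approximation numbers up to index \<open>d choose k\<close> are at least
    \<open>a d 1 ^ k\<close>, so the error cannot drop below this value earlier. Positivity of
    \<open>a d 1\<close> makes it an admissible error threshold.\<close>
  have N_lower: "d choose k \<le> N (a d 1 ^ k) d" if d: "1 \<le> d" and "1 \<le> k" "0 < a d 1" for d k
  proof (rule ccontr)
    assume "\<not> d choose k \<le> N (a d 1 ^ k) d"
    then have "a d 1 ^ k \<le> b d (Suc (N (a d 1 ^ k) d))" using that by (intro lower) auto
    moreover have "b d (Suc (N (a d 1 ^ k) d)) < a d 1 ^ k" using that by (intro N_error) auto
    ultimately show False by simp
  qed
  have "polynomially_tractable N" if "strongly_polynomially_tractable N"
  proof -
    obtain C q where "0 \<le> C" "0 \<le> q" "\<And>d \<epsilon>. \<lbrakk>1 \<le> d; 0 < \<epsilon>\<rbrakk> \<Longrightarrow> real (N \<epsilon> d) \<le> C * \<epsilon> powr (- q)"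
      using \<open>strongly_polynomially_tractable N\<close> unfolding strongly_polynomially_tractable_def by blast
    then show ?thesis
      unfolding polynomially_tractable_def
      by (intro exI[of _ C] exI[of _ 0] exI[of _ q] conjI allI impI) auto
  qed
  moreover have "decays_polynomially (\<lambda>d. a d 1)" if tract: "polynomially_tractable N"
  proof -
    obtain C p q where C: "0 \<le> C" "0 \<le> p" "0 \<le> q"
      "\<And>d \<epsilon>. \<lbrakk>1 \<le> d; 0 < \<epsilon>\<rbrakk> \<Longrightarrow> real (N \<epsilon> d) \<le> C * \<epsilon> powr (- q) * real d powr p"
      using tract unfolding polynomially_tractable_def by blast
    \<comment> \<open>\<open>k > p\<close> makes the resulting decay exponent positive.\<close>
    obtain k :: nat where k: "1 \<le> k" "p < real k"
    proof -
      obtain k :: nat where "max p 1 < real k" using reals_Archimedean2 by blast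
      then show thesis using that[of k] by simp
    qed
    \<comment> \<open>Tractability allows \<open>q = 0\<close>, but the decay exponent is divided by
      \<open>k * q'\<close>.\<close>
    define q' where "q' = max q 1"
    have q': "q \<le> q'" "0 < q'" by (auto simp: q'_def)
    show ?thesis
    proof (rule decays_polynomiallyI_eventually)
      show "0 < (real k - p) / (real k * q')" using k q' by simp
      show "a d 1 \<le> (C * real k powr real k) powr (1 / (k * q')) * real d powr (- ((k - p) / (k * q')))"
        if "d \<ge> k" for d
      proof (cases "a d 1 = 0")
        case False
        have d: "1 \<le> d" using that k by simp
        have pos: "0 < a d 1" using False a_nonneg[OF d, of 1] by simp
        have "real (d choose k) \<le> C * (a d 1 ^ k) powr (- q) * real d powr p"
          using C(4)[OF d, of "a d 1 ^ k"] N_lower[OF d k(1) pos] pos by simp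
        then show ?thesis
          using pos a_le_1[OF d] C(1) k(1) that q' by (intro decay_of_choose_bound[where q = q]) auto
      qed simp
    qed (use a_le_1 in auto)
  qed
  moreover have "strongly_polynomially_tractable N" if "decays_polynomially (\<lambda>d. a d 1)"
  proof -
    obtain C\<^sub>2 p\<^sub>2 where p2: "0 < C\<^sub>2" "0 < p\<^sub>2" "\<And>d. 1 \<le> d \<Longrightarrow> a d 1 \<le> C\<^sub>2 * real d powr (- p\<^sub>2)"
      using \<open>decays_polynomially (\<lambda>d. a d 1)\<close> unfolding decays_polynomially_def by blast
    \<comment> \<open>The exponent for which the sum of the powers exceeds 1 only by a multiple of
      \<open>1 / d\<close>.\<close>
    define r where "r = 2 / p\<^sub>1 + 1 / p\<^sub>2"
    define c where "c = C\<^sub>1 powr (2 / p\<^sub>1) * C\<^sub>2 powr (1 / p\<^sub>2) * (pi\<^sup>2 / 6)"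
    have r: "0 \<le> r" using p1 p2 by (simp add: r_def)
    have c: "0 \<le> c" by (simp add: c_def)
    have "real (N \<epsilon> d) \<le> exp c * 2 powr r * \<epsilon> powr (- r)" if d: "1 \<le> d" and \<epsilon>: "0 < \<epsilon>" for d \<epsilon>
    proof -
      have a_small: "a d k \<le> C\<^sub>2 * real d powr (- p\<^sub>2)" if "1 \<le> k" for k
        using a_antimono[OF d that] p2(3)[OF d] by simp
      have sum_le: "(\<Sum>k<n. a d k powr r) \<le> 1 + c / real d" for n
        unfolding r_def c_def using p1 p2 d a_decay a_nonneg a0 a_small
        by (intro sum_powr_le_of_decay) auto
      have "real (N \<epsilon> d) * (\<epsilon> / 2) powr r \<le> real (card (F d (\<epsilon> / 2))) * (\<epsilon> / 2) powr r"
        using N_upper[OF d \<epsilon>] by (intro mult_right_mono) auto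
      also have "\<dots> \<le> (1 + c / real d) ^ d"
        unfolding F_def by (rule card_large_products[OF _ _ _ _ r sum_le])
          (use d \<epsilon> a_nonneg a_le_1 a_lim in auto)
      \<comment> \<open>The bound loses its dependence on \<open>d\<close> here, which gives strong
        tractability.\<close>
      also have "\<dots> \<le> exp c"
        using c d by (intro exp_ge_one_plus_x_over_n_power_n) auto
      finally have "real (N \<epsilon> d) \<le> exp c / (\<epsilon> / 2) powr r" using \<epsilon> by (simp add: pos_le_divide_eq)
      also have "\<dots> = exp c * 2 powr r * \<epsilon> powr (- r)"
        using \<epsilon> by (simp add: powr_divide powr_minus field_simps)
      finally show ?thesis .
    qed
    then show ?thesis
      unfolding strongly_polynomially_tractable_def using r
      by (intro exI[of _ "exp c * 2 powr r"] exI[of _ r] conjI allI impI) auto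
  qed
  moreover have "(\<lambda>d. a d 1) = (\<lambda>d. approx_number K (X d) (Y d) (T d) 2)"
    by (simp add: a_def numeral_2_eq_2)
  moreover have "(\<lambda>\<epsilon> d. information_complexity K (XT d) (YT d) (TT d) \<epsilon>) = N"
    by (simp add: N_def fun_eq_iff)
  ultimately show ?thesis unfolding Let_def by metis
qed

end
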